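(* Let $(A,b,c)$ be an $s$-stage Runge--Kutta method with $c_i=\sum_{j}a_{ij}$, and let $p\ge 1$ be an integer. The method is of order $p$ for scalar non-autonomous problems $y'(x)=f(y(x),x)$, $y(x_0)=y_0$, $y(x)\in\mathbb{R}$, if and only if for every $q\in\{1,\dots,p\}$ and every isomeric class $u\in U_q$ of rooted trees of order $q$, $$\sum_{t\in u}\frac{1}{\sigma(t)}\Big(\Phi(t)-\frac{1}{t!}\Big)=0 .$$
   Context: Runge--Kutta methods. An $s$-stage Runge--Kutta method is given by $A=(a_{ij})\in\mathbb{R}^{s\times s}$, $b\in\mathbb{R}^s$, $c\in\mathbb{R}^s$ with $c_i=\sum_j a_{ij}$. Applied with step size $h$ to $y'(x)=f(y(x),x)$, $y(x_0)=y_0$, it produces $y_1=y_0+h\sum_i b_i f(Y_i,x_0+c_ih)$, where $Y_i=y_0+h\sum_j a_{ij}f(Y_j,x_0+c_jh)$ (for $|h|$ small, the $Y_i$ are the solution close to $y_0$). The method is of order $p$ for scalar problems if, for every $C^\infty$ function $f$ defined near $(y_0,x_0)\in\mathbb{R}\times\mathbb{R}$, $y_1-y(x_0+h)=O(h^{p+1})$ as $h\to0$. Trees. Rooted trees are finite, unordered and unlabelled (i.e. taken up to isomorphism). $\tau$ denotes the one-vertex tree, and $\tau_m t_1\cdots t_m$ denotes the tree obtained by joining the roots of $t_1,\dots,t_m$ to a new root. The order $|t|$ is the number of vertices. $T_q$ is the set of trees of order $q$. The symmetry $\sigma(t)$ is the order of the automorphism group of the rooted tree $t$. The factorial is defined by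 $\tau!=1$ and $(\tau_m t_1\cdots t_m)!=|\tau_m t_1\cdots t_m|\prod_i t_i!$. The elementary weight is $\Phi(t)=\sum_i b_i\phi_i(t)$, where $\phi_i(\tau)=1$ and $\phi_i(\tau_m t_1\cdots t_m)=\prod_{k=1}^m\sum_j a_{ij}\phi_j(t_k)$. Atomic stumps and isomeric classes. The atomic stump $s_{mn}$ consists of a root with $m$ leaf children and $n$ unfilled valencies. Each tree $t\neq\tau$ factorises into atomic stumps: each non-leaf vertex of $t$ having $m$ leaf children and $n$ non-leaf children contributes one factor $s_{mn}$. For $t=\tau$ the single factor is $s_{00}$. Two trees are isomeric if they have the same multiset of atomic stump factors. $U_q$ is the set of equivalence classes of $T_q$ under this relation (including singleton classes). *)

theory Defs
  imports "HOL-Analysis.Analysis" "HOL-Library.Landau_Symbols" "HOL-Library.Multiset"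
    "HOL-Combinatorics.Permutations"
begin

section \<open>Smooth functions\<close>

text \<open>Intended for open \<open>S\<close>. Quantifying over all directions \<open>v\<close> covers all mixed partial
  derivatives.\<close>

fun Ck_on :: "nat \<Rightarrow> ('a::real_normed_vector \<Rightarrow> 'b::real_normed_vector) \<Rightarrow> 'a set \<Rightarrow> bool" where
  "Ck_on 0 f S \<longleftrightarrow> continuous_on S f"
| "Ck_on (Suc k) f S \<longleftrightarrow>
     (\<forall>x\<in>S. f differentiable (at x)) \<and>
     (\<forall>v. Ck_on k (\<lambda>x. frechet_derivative f (at x) v) S)"

definition smooth_on :: "('a::real_normed_vector \<Rightarrow> 'b::real_normed_vector) \<Rightarrow> 'a set \<Rightarrow> bool" where
  "smooth_on f S \<longleftrightarrow> (\<forall>k. Ck_on k f S)"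


section \<open>Runge--Kutta methods for scalar problems\<close>

text \<open>The stages are indexed by the finite type \<open>'s\<close>. The right-hand side is written
  \<open>f (y, x)\<close>, with the dependent variable first, and only its values on \<open>S\<close> matter.\<close>

definition ivp_solution ::
  "(real \<times> real \<Rightarrow> real) \<Rightarrow> (real \<times> real) set \<Rightarrow> real \<Rightarrow> real \<Rightarrow> (real \<Rightarrow> real) \<Rightarrow> bool" where
  "ivp_solution f S x0 y0 y \<longleftrightarrow>
     y x0 = y0 \<and>
     (\<forall>\<^sub>F x in nhds x0. (y x, x) \<in> S \<and> (y has_real_derivative f (y x, x)) (at x))"

text \<open>The stages are implicitly defined. The condition \<open>Y h \<longlongrightarrow> y0\<close> selects the solution close
  to \<open>y0\<close>, which for small \<open>h\<close> exists and is unique.\<close>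

definition rk_stages ::
  "real^'s^'s \<Rightarrow> real^'s \<Rightarrow> (real \<times> real \<Rightarrow> real) \<Rightarrow> (real \<times> real) set \<Rightarrow> real \<Rightarrow> real
     \<Rightarrow> (real \<Rightarrow> real^'s) \<Rightarrow> bool" where
  "rk_stages A c f S x0 y0 Y \<longleftrightarrow>
     (\<forall>i. ((\<lambda>h. Y h $ i) \<longlongrightarrow> y0) (at 0)) \<and>
     (\<forall>\<^sub>F h in at 0. \<forall>i. (Y h $ i, x0 + c $ i * h) \<in> S \<and>
        Y h $ i = y0 + h * (\<Sum>j\<in>UNIV. A $ i $ j * f (Y h $ j, x0 + c $ j * h)))"

definition rk_step ::
  "real^'s \<Rightarrow> real^'s \<Rightarrow> (real \<times> real \<Rightarrow> real) \<Rightarrow> real \<Rightarrow> real \<Rightarrow> (real \<Rightarrow> real^'s) \<Rightarrow> real \<Rightarrow> real"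
  where
  "rk_step b c f x0 y0 Y h =
     y0 + h * (\<Sum>i\<in>UNIV. b $ i * f (Y h $ i, x0 + c $ i * h))"

definition rk_scalar_order :: "real^'s^'s \<Rightarrow> real^'s \<Rightarrow> real^'s \<Rightarrow> nat \<Rightarrow> bool" where
  "rk_scalar_order A b c p \<longleftrightarrow>
     (\<forall>f S x0 y0 y Y.
        open S \<and> (y0, x0) \<in> S \<and> smooth_on f S \<and>
        ivp_solution f S x0 y0 y \<and> rk_stages A c f S x0 y0 Y \<longrightarrow>
        (\<lambda>h. rk_step b c f x0 y0 Y h - y (x0 + h)) \<in> O[at 0](\<lambda>h. h ^ (p + 1)))"


section \<open>Rooted trees\<close>

text \<open>A finite unordered unlabelled rooted tree is the multiset of the trees attached to its
  root.\<close>

datatype rtree = Node (children: "rtree multiset")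

abbreviation leaf :: rtree where
  "leaf \<equiv> Node {#}"

primrec tree_order :: "rtree \<Rightarrow> nat" where
  "tree_order (Node ts) = Suc (\<Sum>\<^sub># (image_mset tree_order ts))"

definition trees_of_order :: "nat \<Rightarrow> rtree set" where
  "trees_of_order q = {t. tree_order t = q}"

primrec tree_factorial :: "rtree \<Rightarrow> nat" where
  "tree_factorial (Node ts) = tree_order (Node ts) * \<Prod>\<^sub># (image_mset tree_factorial ts)"

text \<open>To speak about automorphisms the vertices need names. A vertex is the path leading to it
  from the root; a step \<open>(s, i)\<close> goes to the \<open>i\<close>-th copy of the child tree \<open>s\<close>.\<close>

fun is_vertex :: "rtree \<Rightarrow> (rtree \<times> nat) list \<Rightarrow> bool" where
  "is_vertex t [] \<longleftrightarrow> True"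
| "is_vertex t ((s, i) # v) \<longleftrightarrow> i < count (children t) s \<and> is_vertex s v"

definition vertices :: "rtree \<Rightarrow> (rtree \<times> nat) list set" where
  "vertices t = {v. is_vertex t v}"

definition edges :: "rtree \<Rightarrow> ((rtree \<times> nat) list \<times> (rtree \<times> nat) list) set" where
  "edges t = {(v, v @ [x]) | v x. v \<in> vertices t \<and> v @ [x] \<in> vertices t}"

definition automorphisms :: "rtree \<Rightarrow> ((rtree \<times> nat) list \<Rightarrow> (rtree \<times> nat) list) set" where
  "automorphisms t =
     {\<pi>. \<pi> permutes vertices t \<and> \<pi> [] = [] \<and>
         (\<forall>v\<in>vertices t. \<forall>w\<in>vertices t. (v, w) \<in> edges t \<longleftrightarrow> (\<pi> v, \<pi> w) \<in> edges t)}"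

definition symmetry :: "rtree \<Rightarrow> nat" where
  "symmetry t = card (automorphisms t)"

primrec stage_weight :: "real^'s^'s \<Rightarrow> rtree \<Rightarrow> 's \<Rightarrow> real" where
  "stage_weight A (Node ts) =
     (\<lambda>i. \<Prod>\<^sub># (image_mset (\<lambda>t. \<Sum>j\<in>UNIV. A $ i $ j * stage_weight A t j) ts))"

definition elementary_weight :: "real^'s^'s \<Rightarrow> real^'s \<Rightarrow> rtree \<Rightarrow> real" where
  "elementary_weight A b t = (\<Sum>i\<in>UNIV. b $ i * stage_weight A t i)"


section \<open>Atomic stumps and isomeric classes\<close>

text \<open>The pair \<open>(m, n)\<close> stands for the atomic stump with \<open>m\<close> leaf children and \<open>n\<close> unfilled
  valencies.\<close>

primrec inner_stumps :: "rtree \<Rightarrow> (nat \<times> nat) multiset" where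
  "inner_stumps (Node ts) =
     (if ts = {#} then {#}
      else add_mset
        (size (filter_mset (\<lambda>t. t = leaf) ts), size (filter_mset (\<lambda>t. t \<noteq> leaf) ts))
        (\<Sum>\<^sub># (image_mset inner_stumps ts)))"

definition stump_factors :: "rtree \<Rightarrow> (nat \<times> nat) multiset" where
  "stump_factors t = (if t = leaf then {#(0, 0)#} else inner_stumps t)"

definition isomeric_on :: "nat \<Rightarrow> (rtree \<times> rtree) set" where
  "isomeric_on q =
     {(t, t'). t \<in> trees_of_order q \<and> t' \<in> trees_of_order q \<and> stump_factors t = stump_factors t'}"

definition isomeric_classes :: "nat \<Rightarrow> rtree set set" where
  "isomeric_classes q = trees_of_order q // isomeric_on q"


section \<open>Well-definedness of the cardinality and of the sums over classes\<close>

lemma finite_vertices: "finite (vertices t)"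
proof (induction t)
  case (Node ts)
  have "vertices (Node ts) \<subseteq> insert [] (\<Union>s\<in>set_mset ts. (\<lambda>(i, v). (s, i) # v) ` ({..<count ts s} \<times> vertices s))"
  proof
    fix v assume v: "v \<in> vertices (Node ts)"
    show "v \<in> insert [] (\<Union>s\<in>set_mset ts. (\<lambda>(i, v). (s, i) # v) ` ({..<count ts s} \<times> vertices s))"
    proof (cases v)
      case (Cons x w)
      obtain s i where x: "x = (s, i)" by (cases x)
      have i: "i < count ts s" and w: "w \<in> vertices s"
        using v Cons x by (simp_all add: vertices_def)
      have "s \<in># ts" using i by (metis count_greater_zero_iff gr_zeroI not_less_zero)
      moreover have "v = (\<lambda>(i, v). (s, i) # v) (i, w)" using Cons x by simp
      ultimately show ?thesis using i w by blast
    qed simp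
  qed
  then show ?case by (rule finite_subset) (simp add: Node)
qed

lemma symmetry_pos: "symmetry t > 0"
proof -
  have "finite (automorphisms t)"
    by (rule finite_subset[OF _ finite_permutations[OF finite_vertices[of t]]]) (auto simp: automorphisms_def)
  moreover have "id \<in> automorphisms t" by (auto simp: automorphisms_def permutes_id)
  ultimately show ?thesis by (auto simp: symmetry_def card_gt_0_iff)
qed

lemma tree_order_pos: "tree_order t > 0" by (cases t) simp

lemma finite_bounded_multisets:
  assumes "finite B"
  shows "finite {M. set_mset M \<subseteq> B \<and> size M \<le> n}"
proof -
  have "finite {xs. set xs \<subseteq> B \<and> length xs \<le> n}" using assms by (rule finite_lists_length_le)
  then have "finite (mset ` {xs. set xs \<subseteq> B \<and> length xs \<le> n})" by simp
  moreover have "{M. set_mset M \<subseteq> B \<and> size M \<le> n} \<subseteq> mset ` {xs. set xs \<subseteq> B \<and> length xs \<le> n}"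
  proof
    fix M assume M: "M \<in> {M. set_mset M \<subseteq> B \<and> size M \<le> n}"
    obtain xs where "mset xs = M" using ex_mset by blast
    then show "M \<in> mset ` {xs. set xs \<subseteq> B \<and> length xs \<le> n}" using M by auto
  qed
  ultimately show ?thesis by (rule finite_subset[rotated])
qed

lemma size_le_sum_order: "size ts \<le> \<Sum>\<^sub># (image_mset tree_order ts)"
proof (induction ts)
  case (add x ts) then show ?case using tree_order_pos[of x] by simp
qed simp

lemma order_le_sum_order: "t \<in># ts \<Longrightarrow> tree_order t \<le> \<Sum>\<^sub># (image_mset tree_order ts)"
  by (induction ts) auto

lemma finite_order_le: "finite {t. tree_order t \<le> q}"
proof (induction q)
  case 0
  have "tree_order t \<noteq> 0" for t using tree_order_pos[of t] by simp
  then have "{t. tree_order t \<le> 0} = {}" by (simp only: le_zero_eq simp_thms Collect_empty_eq)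
  then show ?case by (simp only: finite.emptyI)
next
  case (Suc q)
  have sub: "{t. tree_order t \<le> Suc q} \<subseteq> Node ` {M. set_mset M \<subseteq> {t. tree_order t \<le> q} \<and> size M \<le> q}"
  proof
    fix t assume t: "t \<in> {t. tree_order t \<le> Suc q}"
    have le: "\<Sum>\<^sub># (image_mset tree_order (children t)) \<le> q"
      using t by (cases t) simp
    have "set_mset (children t) \<subseteq> {t. tree_order t \<le> q}"
      by (intro subsetI CollectI order_trans[OF order_le_sum_order le])
    moreover have "size (children t) \<le> q" by (rule order_trans[OF size_le_sum_order le])
    ultimately have "children t \<in> {M. set_mset M \<subseteq> {t. tree_order t \<le> q} \<and> size M \<le> q}" by (intro CollectI conjI)
    then have "Node (children t) \<in> Node ` {M. set_mset M \<subseteq> {t. tree_order t \<le> q} \<and> size M \<le> q}"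
      by (rule imageI)
    then show "t \<in> Node ` {M. set_mset M \<subseteq> {t. tree_order t \<le> q} \<and> size M \<le> q}"
      by (simp only: rtree.collapse)
  qed
  show ?case by (rule finite_subset[OF sub finite_imageI[OF finite_bounded_multisets[OF Suc.IH]]])
qed

lemma finite_trees_of_order: "finite (trees_of_order q)"
  by (rule finite_subset[OF _ finite_order_le[of q]]) (auto simp: trees_of_order_def)

end

theory Submission
  imports Defs "HOL-Computational_Algebra.Primes" "HOL-Computational_Algebra.Polynomial"
begin

text \<open>In the autonomous system for \<open>(y, x)\<close> the elementary differential of a leaf is
  \<open>(f, 1)\<close>, and that of every other tree has vanishing second component. Hence its first component
  \<open>F t\<close> is a product of scalars \<open>D (m, n)\<close> over the atomic stumps of \<open>t\<close>, and depends only on the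
  isomeric class of \<open>t\<close>. The numerical and the exact solution are B-series with weights
  \<open>\<Phi> t\<close> and \<open>1 / t!\<close>, so the coefficient of \<open>h ^ q\<close> in the error is
  \<open>\<Sum>t. F t / \<sigma> t * (\<Phi> t - 1 / t!)\<close>, the sum ranging over the trees of order \<open>q\<close>. As the numbers
  \<open>D (m, n)\<close> can be prescribed arbitrarily, and the monomials belonging to different isomeric classes
  are linearly independent, it vanishes for all \<open>f\<close> iff the partial sum over each class does.\<close>


section \<open>Expansions over multisets\<close>

text \<open>The directions (f, 1) and (1, 0) form a basis of the plane whatever the value of f is.
  In the corresponding coordinates the leaf term of a B-series is a multiple of the first direction,
  every other term a multiple of the second. Substituting the series into the Taylor polynomial
  therefore turns a monomial of bidegree (m, n) into trees with m leaves and n other subtrees at the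
  root. As the change of coordinates is always invertible, D (0, 0) can be chosen freely although it
  fixes a direction. A tree of order at most p has only stumps with m + n < p, so total degree below
  p suffices. The number \<sigma> has two origins: the expansion produces factorials of
  multiplicities, the definition counts automorphisms. \<open>symmetry_Node\<close> reconciles them.
  \<open>rk_scalar_order\<close> speaks about given solutions and given stages. Sufficiency uses
  only the equations that these satisfy, but necessity needs a test problem for which both actually
  exist.\<close>

text \<open>The term w^M / M! of the multinomial theorem, with a multiset as multi-index. The
  factorials stay inside because they become part of the symmetry of a tree.\<close>

definition divided_monomial :: "('a \<Rightarrow> real) \<Rightarrow> 'a multiset \<Rightarrow> real" where
  "divided_monomial w M = (\<Prod>t\<in>set_mset M. w t ^ count M t / fact (count M t))"

lemma divided_monomial_superset:
  assumes "finite B" "set_mset M \<subseteq> B"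
  shows "divided_monomial w M = (\<Prod>t\<in>B. w t ^ count M t / fact (count M t))"
  unfolding divided_monomial_def
  by (rule prod.mono_neutral_left) (use assms in \<open>auto simp: not_in_iff\<close>)

lemma divided_monomial_add_replicate:
  assumes "b \<notin># M"
  shows "divided_monomial w (M + replicate_mset m b) = w b ^ m / fact m * divided_monomial w M"
proof -
  have "divided_monomial w (M + replicate_mset m b) =
      (\<Prod>t\<in>insert b (set_mset M). w t ^ count (M + replicate_mset m b) t / fact (count (M + replicate_mset m b) t))"
    by (rule divided_monomial_superset) auto
  also have "\<dots> = w b ^ m / fact m *
      (\<Prod>t\<in>set_mset M. w t ^ count (M + replicate_mset m b) t / fact (count (M + replicate_mset m b) t))"
    using assms by (simp add: not_in_iff)
  also have "(\<Prod>t\<in>set_mset M. w t ^ count (M + replicate_mset m b) t / fact (count (M + replicate_mset m b) t))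
      = divided_monomial w M"
    unfolding divided_monomial_def by (rule prod.cong) (use assms in auto)
  finally show ?thesis .
qed

abbreviation multisets_of_size :: "'a set \<Rightarrow> nat \<Rightarrow> 'a multiset set" where
  "multisets_of_size B n \<equiv> {M. set_mset M \<subseteq> B \<and> size M = n}"

lemma finite_multisets_of_size: "finite B \<Longrightarrow> finite (multisets_of_size B n)"
  by (rule finite_subset[OF _ finite_bounded_multisets[of B n]]) auto

lemma filter_neq_add_replicate: "filter_mset (\<lambda>t. t \<noteq> b) M + replicate_mset (count M b) b = M"
  by (rule multiset_eqI) simp

lemma size_filter_neq: "size (filter_mset (\<lambda>t. t \<noteq> b) M) = size M - count M b"
  using arg_cong[OF filter_neq_add_replicate[of b M], of size] by simp

lemma count_le_size: "count M b \<le> size M"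
  using arg_cong[OF filter_neq_add_replicate[of b M], of size] by simp

lemma filter_neq_self: "b \<notin># M \<Longrightarrow> filter_mset (\<lambda>t. t \<noteq> b) M = M"
  by (rule multiset_eqI) (auto simp: not_in_iff)

text \<open>The multinomial theorem divided by n!. With the factorials absorbed the binomial theorem
  is a plain convolution, so splitting off one variable b amounts to splitting a multiset into its
  copies of b and the rest.\<close>

lemma sum_power_eq_sum_divided_monomials:
  assumes "finite B"
  shows "(\<Sum>t\<in>B. w t) ^ n / fact n = (\<Sum>M\<in>multisets_of_size B n. divided_monomial w M)"
  using assms
proof (induction B arbitrary: n rule: finite_induct)
  case empty
  have "multisets_of_size {} n = (if n = 0 then {{#} :: 'a multiset} else {})"
    by auto
  then show ?case by (simp add: power_0_left divided_monomial_def)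
next
  case (insert b B)
  have "(\<Sum>t\<in>insert b B. w t) ^ n / fact n
      = (\<Sum>j\<le>n. w b ^ j / fact j * ((\<Sum>t\<in>B. w t) ^ (n - j) / fact (n - j)))"
    using exp_series_add_commuting[of "w b" "\<Sum>t\<in>B. w t" n] insert.hyps
    by (simp add: divide_inverse mult_ac)
  also have "\<dots> = (\<Sum>j\<le>n. \<Sum>M\<in>multisets_of_size B (n - j). w b ^ j / fact j * divided_monomial w M)"
    by (simp only: insert.IH sum_distrib_left)
  also have "\<dots> = (\<Sum>(j, M)\<in>(SIGMA j:{..n}. multisets_of_size B (n - j)). w b ^ j / fact j * divided_monomial w M)"
    by (rule sum.Sigma) (use insert.hyps in \<open>auto intro: finite_multisets_of_size\<close>)
  also have "\<dots> = (\<Sum>M\<in>multisets_of_size (insert b B) n. divided_monomial w M)"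
  proof (rule sum.reindex_bij_witness[where
        i = "\<lambda>M. (count M b, filter_mset (\<lambda>t. t \<noteq> b) M)" and j = "\<lambda>(j, M). M + replicate_mset j b"])
    fix a assume a: "a \<in> (SIGMA j:{..n}. multisets_of_size B (n - j))"
    obtain j M where jM: "a = (j, M)" by (cases a)
    from a jM insert.hyps have b: "b \<notin># M" by auto
    show "(count (case a of (j, M) \<Rightarrow> M + replicate_mset j b) b,
        filter_mset (\<lambda>t. t \<noteq> b) (case a of (j, M) \<Rightarrow> M + replicate_mset j b)) = a"
      using b jM by (simp add: filter_neq_self not_in_iff)
    show "(case a of (j, M) \<Rightarrow> M + replicate_mset j b) \<in> multisets_of_size (insert b B) n"
      using a jM by (auto split: if_splits)
    show "divided_monomial w (case a of (j, M) \<Rightarrow> M + replicate_mset j b) =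
        (case a of (j, M) \<Rightarrow> w b ^ j / fact j * divided_monomial w M)"
      using b jM by (simp add: divided_monomial_add_replicate)
  next
    fix M assume M: "M \<in> multisets_of_size (insert b B) n"
    show "(case (count M b, filter_mset (\<lambda>t. t \<noteq> b) M) of (j, M) \<Rightarrow> M + replicate_mset j b) = M"
      by (simp add: filter_neq_add_replicate)
    show "(count M b, filter_mset (\<lambda>t. t \<noteq> b) M) \<in> (SIGMA j:{..n}. multisets_of_size B (n - j))"
      using M count_le_size[of M b] by (auto simp: size_filter_neq)
  qed
  finally show ?case .
qed

lemma finite_pairs_sum_less: "finite {(m, n). m + n < (k :: nat)}"
  by (rule finite_subset[of _ "{..<k} \<times> {..<k}"]) auto

text \<open>In the application b is the leaf and B a set of other trees. The exponent m gives the
  copies of b and the n-th power a multiset of size n over B; since (m, n) can be read off from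
  their union, a Taylor polynomial becomes a sum over the possible children of a root.\<close>

lemma sum_bivariate_eq_sum_divided_monomials:
  fixes D :: "nat \<times> nat \<Rightarrow> real"
  assumes "finite B" "b \<notin> B"
  shows "(\<Sum>(m, n) | m + n < p. D (m, n) / (fact m * fact n) * w b ^ m * (\<Sum>t\<in>B. w t) ^ n) =
    (\<Sum>M | set_mset M \<subseteq> insert b B \<and> size M < p.
      D (count M b, size M - count M b) * divided_monomial w M)"
proof -
  let ?P = "{(m, n). m + n < p} :: (nat \<times> nat) set"
  have "(\<Sum>(m, n)\<in>?P. D (m, n) / (fact m * fact n) * w b ^ m * (\<Sum>t\<in>B. w t) ^ n) =
    (\<Sum>x\<in>?P. \<Sum>M\<in>multisets_of_size B (snd x). D x * (w b ^ fst x / fact (fst x)) * divided_monomial w M)"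
    by (rule sum.cong)
      (auto simp: sum_distrib_left[symmetric] sum_power_eq_sum_divided_monomials[OF assms(1), symmetric]
        simp del: times_divide_eq_left times_divide_eq_right, simp)
  also have "\<dots> = (\<Sum>(x, M)\<in>(SIGMA x:?P. multisets_of_size B (snd x)).
      D x * (w b ^ fst x / fact (fst x)) * divided_monomial w M)"
    by (rule sum.Sigma) (use assms finite_pairs_sum_less in \<open>auto intro: finite_multisets_of_size\<close>)
  also have "\<dots> = (\<Sum>M | set_mset M \<subseteq> insert b B \<and> size M < p.
      D (count M b, size M - count M b) * divided_monomial w M)"
  proof (rule sum.reindex_bij_witness[where
        i = "\<lambda>M. ((count M b, size M - count M b), filter_mset (\<lambda>t. t \<noteq> b) M)" and
        j = "\<lambda>(x, M). M + replicate_mset (fst x) b"])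
    fix a assume a: "a \<in> (SIGMA x:?P. multisets_of_size B (snd x))"
    obtain m n M where jM: "a = ((m, n), M)" by (cases a; cases "fst a") auto
    from a jM assms have b: "b \<notin># M" by auto
    have sz: "size M = n" using a jM by simp
    let ?N = "case a of (x, M) \<Rightarrow> M + replicate_mset (fst x) b"
    show "((count ?N b, size ?N - count ?N b), filter_mset (\<lambda>t. t \<noteq> b) ?N) = a"
      using b jM sz by (simp add: filter_neq_self not_in_iff)
    show "?N \<in> {M. set_mset M \<subseteq> insert b B \<and> size M < p}"
      using a jM by (auto split: if_splits)
    show "D (count ?N b, size ?N - count ?N b) * divided_monomial w ?N =
        (case a of (x, M) \<Rightarrow> D x * (w b ^ fst x / fact (fst x)) * divided_monomial w M)"
      using b jM sz by (simp add: divided_monomial_add_replicate not_in_iff)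
  next
    fix M assume M: "M \<in> {M. set_mset M \<subseteq> insert b B \<and> size M < p}"
    show "(case ((count M b, size M - count M b), filter_mset (\<lambda>t. t \<noteq> b) M) of
        (x, M) \<Rightarrow> M + replicate_mset (fst x) b) = M"
      by (simp add: filter_neq_add_replicate)
    show "((count M b, size M - count M b), filter_mset (\<lambda>t. t \<noteq> b) M) \<in> (SIGMA x:?P. multisets_of_size B (snd x))"
      using M count_le_size[of M b] by (auto simp: size_filter_neq)
  qed
  finally show ?thesis by simp
qed

section \<open>Linear independence of monomials indexed by multisets\<close>

lemma monomials_linearly_independent:
  fixes a :: "'a::countable multiset \<Rightarrow> real"
  assumes fin: "finite \<M>"
    and zero: "\<And>D. (\<Sum>M\<in>\<M>. a M * \<Prod>\<^sub># (image_mset D M)) = 0"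
    and M0: "M0 \<in> \<M>"
  shows "a M0 = 0"
proof -
  \<comment> \<open>At powers of distinct primes the monomials become powers of distinct integers, which a
    Lagrange polynomial separates.\<close>
  define P where "P x = enumerate {p::nat. prime p} (to_nat (x::'a))" for x
  define N where "N M = \<Prod>\<^sub># (image_mset P M)" for M
  have inf: "infinite {p::nat. prime p}" by (rule primes_infinite)
  have prime: "prime (P x)" for x
    using enumerate_in_set[OF inf] by (auto simp: P_def)
  have "inj P"
  proof (rule injI)
    fix x y assume "P x = P y"
    then have "to_nat x = to_nat y"
      unfolding P_def using strict_mono_enumerate[OF inf] by (simp add: strict_mono_eq)
    then show "x = y" by simp
  qed
  have fac: "prime_factorization (N M) = image_mset P M" for M
    unfolding N_def by (rule prime_factorization_prod_mset_primes) (use prime in auto)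
  have "inj N"
  proof (rule injI)
    fix M M' assume "N M = N M'"
    then have "image_mset P M = image_mset P M'" using fac by metis
    then show "M = M'" using injD[OF multiset.inj_map[OF \<open>inj P\<close>]] by blast
  qed
  \<comment> \<open>Raising all variables to the power s raises every monomial to that power. As s
    is free, linearity makes the sum vanish for every polynomial in \<open>N M\<close>.\<close>
  have powers: "(\<Sum>M\<in>\<M>. a M * real (N M) ^ s) = 0" for s
  proof -
    have "\<Prod>\<^sub># (image_mset (\<lambda>x. real (P x) ^ s) M) = real (N M) ^ s" for M
      unfolding N_def by (induction M) (auto simp: power_mult_distrib)
    then show ?thesis using zero[of "\<lambda>x. real (P x) ^ s"] by simp
  qed
  define r where "r = (\<Prod>M\<in>\<M> - {M0}. [:- real (N M), 1:])"
  have "(\<Sum>M\<in>\<M>. a M * poly r (real (N M))) = (\<Sum>i\<le>degree r. coeff r i * (\<Sum>M\<in>\<M>. a M * real (N M) ^ i))"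
    by (simp add: poly_altdef sum_distrib_left sum.swap[of _ "{..degree r}"] mult_ac)
  also have "\<dots> = 0" by (simp add: powers)
  finally have "(\<Sum>M\<in>\<M>. a M * poly r (real (N M))) = 0" .
  moreover have "poly r (real (N M)) = 0" if "M \<in> \<M> - {M0}" for M
    unfolding r_def poly_prod using fin that by (intro prod_zero) auto
  ultimately have "a M0 * poly r (real (N M0)) = 0"
    using sum.remove[OF fin M0, of "\<lambda>M. a M * poly r (real (N M))"] by simp
  moreover have "poly r (real (N M0)) \<noteq> 0"
    unfolding r_def poly_prod using fin \<open>inj N\<close> by (auto simp: inj_eq)
  ultimately show ?thesis by simp
qed


section \<open>The symmetry of a tree\<close>

lemma is_vertex_append: "is_vertex t (v @ w) \<Longrightarrow> is_vertex t v"
  by (induction t v rule: is_vertex.induct) auto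

text \<open>The children of the root made distinguishable: the possible first steps of a vertex
  path.\<close>

definition slots :: "rtree multiset \<Rightarrow> (rtree \<times> nat) set" where
  "slots ts = (SIGMA s:set_mset ts. {..<count ts s})"

lemma finite_slots: "finite (slots ts)"
  by (simp add: slots_def)

lemma slots_iff: "x \<in> slots ts \<longleftrightarrow> snd x < count ts (fst x)"
  by (cases x) (auto simp: slots_def simp flip: count_greater_zero_iff)

lemma is_vertex_Cons: "is_vertex (Node ts) (x # v) \<longleftrightarrow> x \<in> slots ts \<and> is_vertex (fst x) v"
  by (cases x) (simp add: slots_iff)

lemma fst_slots: "fst ` slots ts = set_mset ts"
proof
  show "set_mset ts \<subseteq> fst ` slots ts"
  proof
    fix s assume "s \<in># ts"
    then have "(s, 0) \<in> slots ts" by (simp add: slots_iff)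
    then show "s \<in> fst ` slots ts" by force
  qed
qed (auto simp: slots_def)

lemma card_slots_fibre: "card {x \<in> slots ts. fst x = s} = count ts s"
proof -
  have "{x \<in> slots ts. fst x = s} = Pair s ` {..<count ts s}"
    by (auto simp: slots_iff)
  then show ?thesis by (simp add: card_image inj_on_def)
qed

text \<open>Two trees are allowed so that subtrees at different children can be compared. The
  condition on path extensions goes in one direction only, which suits induction along paths; the
  converse follows from injectivity, since parents are unique.\<close>

definition tree_iso :: "rtree \<Rightarrow> rtree \<Rightarrow> ((rtree \<times> nat) list \<Rightarrow> (rtree \<times> nat) list) \<Rightarrow> bool" where
  "tree_iso t t' \<pi> \<longleftrightarrow> bij_betw \<pi> (vertices t) (vertices t') \<and> \<pi> [] = [] \<and>
     (\<forall>v x. v @ [x] \<in> vertices t \<longrightarrow> (\<exists>y. \<pi> (v @ [x]) = \<pi> v @ [y]))"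

lemma automorphisms_iff_tree_iso:
  "\<pi> \<in> automorphisms t \<longleftrightarrow> \<pi> permutes vertices t \<and> tree_iso t t \<pi>"
proof
  assume \<pi>: "\<pi> \<in> automorphisms t"
  then have perm: "\<pi> permutes vertices t" and root: "\<pi> [] = []"
    and ed: "\<And>v w. v \<in> vertices t \<Longrightarrow> w \<in> vertices t \<Longrightarrow> (v, w) \<in> edges t \<longleftrightarrow> (\<pi> v, \<pi> w) \<in> edges t"
    by (auto simp: automorphisms_def)
  have "\<exists>y. \<pi> (v @ [x]) = \<pi> v @ [y]" if "v @ [x] \<in> vertices t" for v x
  proof -
    have v: "v \<in> vertices t" using that is_vertex_append by (auto simp: vertices_def)
    then have "(v, v @ [x]) \<in> edges t" unfolding edges_def using that by blast
    then have "(\<pi> v, \<pi> (v @ [x])) \<in> edges t" using ed[OF v that] by simp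
    then show ?thesis by (auto simp: edges_def)
  qed
  then show "\<pi> permutes vertices t \<and> tree_iso t t \<pi>"
    using perm root permutes_imp_bij[OF perm] by (simp add: tree_iso_def)
next
  assume \<pi>: "\<pi> permutes vertices t \<and> tree_iso t t \<pi>"
  then have perm: "\<pi> permutes vertices t" and root: "\<pi> [] = []"
    and ext: "\<And>v x. v @ [x] \<in> vertices t \<Longrightarrow> \<exists>y. \<pi> (v @ [x]) = \<pi> v @ [y]"
    by (auto simp: tree_iso_def)
  have "(v, w) \<in> edges t \<longleftrightarrow> (\<pi> v, \<pi> w) \<in> edges t" if v: "v \<in> vertices t" and w: "w \<in> vertices t" for v w
  proof
    assume "(v, w) \<in> edges t"
    then obtain x where x: "w = v @ [x]" by (auto simp: edges_def)
    obtain y where "\<pi> w = \<pi> v @ [y]" using ext w x by blast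
    then show "(\<pi> v, \<pi> w) \<in> edges t"
      using permutes_in_image[OF perm, of v] permutes_in_image[OF perm, of w] v w
      unfolding edges_def by (intro CollectI exI[of _ "\<pi> v"] exI[of _ y]) simp
  next
    assume "(\<pi> v, \<pi> w) \<in> edges t"
    then obtain y where y: "\<pi> w = \<pi> v @ [y]" by (auto simp: edges_def)
    then have "w \<noteq> []" using root by auto
    \<comment> \<open>The parent of w is sent to the parent of \<open>\<pi> w\<close>, which is
      \<open>\<pi> v\<close>; injectivity then identifies it with v.\<close>
    then obtain v' x where w': "w = v' @ [x]" by (metis rev_exhaust)
    then obtain y' where "\<pi> w = \<pi> v' @ [y']" using ext w by blast
    then have "\<pi> v = \<pi> v'" using y by simp
    then have "v = v'" using permutes_inj[OF perm] by (simp add: inj_eq)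
    then show "(v, w) \<in> edges t" using v w w' unfolding edges_def by blast
  qed
  then show "\<pi> \<in> automorphisms t" using perm root by (simp add: automorphisms_def)
qed

text \<open>An isomorphism matches the children of the two roots by \<open>\<rho>\<close> and
  restricts to an isomorphism \<open>\<phi> x\<close> of the subtrees at matched children. As
  vertices are paths, the two are the first step and the remainder of the image path.\<close>

lemma tree_iso_decompose:
  assumes iso: "tree_iso (Node ts) (Node ts') \<pi>"
  defines "\<rho> \<equiv> \<lambda>x. hd (\<pi> [x])" and "\<phi> \<equiv> \<lambda>x v. tl (\<pi> (x # v))"
  shows "bij_betw \<rho> (slots ts) (slots ts')"
    and "\<And>x v. x # v \<in> vertices (Node ts) \<Longrightarrow> \<pi> (x # v) = \<rho> x # \<phi> x v"
    and "\<And>x. x \<in> slots ts \<Longrightarrow> tree_iso (fst x) (fst (\<rho> x)) (\<phi> x)"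
proof -
  have bij: "bij_betw \<pi> (vertices (Node ts)) (vertices (Node ts'))" and root: "\<pi> [] = []"
    and ext: "\<And>v x. v @ [x] \<in> vertices (Node ts) \<Longrightarrow> \<exists>y. \<pi> (v @ [x]) = \<pi> v @ [y]"
    using iso by (auto simp: tree_iso_def)
  have inj: "inj_on \<pi> (vertices (Node ts))" and img: "\<pi> ` vertices (Node ts) = vertices (Node ts')"
    using bij by (auto simp: bij_betw_def)
  have V: "x # v \<in> vertices (Node ts) \<longleftrightarrow> x \<in> slots ts \<and> v \<in> vertices (fst x)" for x v
    by (simp add: vertices_def is_vertex_Cons del: is_vertex.simps(2))
  have V': "x # v \<in> vertices (Node ts') \<longleftrightarrow> x \<in> slots ts' \<and> v \<in> vertices (fst x)" for x v
    by (simp add: vertices_def is_vertex_Cons del: is_vertex.simps(2))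
  have nil: "[] \<in> vertices t" for t by (simp add: vertices_def)
  have single: "\<pi> [x] = [\<rho> x]" if "x \<in> slots ts" for x
    using ext[of "[]" x] root that by (auto simp: V nil \<rho>_def)
  have Cons: "\<pi> (x # v) = \<rho> x # \<phi> x v" if "x # v \<in> vertices (Node ts)" for x v
    using that
  \<comment> \<open>Induction from the end of the path, because \<open>tree_iso\<close> controls the
    addition of a last step while the claim concerns the first one.\<close>
  proof (induction v rule: rev_induct)
    case Nil
    then show ?case using single V by (simp add: \<phi>_def)
  next
    case (snoc y v)
    have "x # v \<in> vertices (Node ts)"
      using snoc.prems is_vertex_append[of "Node ts" "x # v" "[y]"] by (simp add: vertices_def)
    then have IH: "\<pi> (x # v) = \<rho> x # \<phi> x v" by (rule snoc.IH)
    obtain z where "\<pi> (x # v @ [y]) = \<pi> (x # v) @ [z]" using ext[of "x # v" y] snoc.prems by auto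
    then show ?case unfolding IH by (simp add: \<phi>_def)
  qed
  then show "\<And>x v. x # v \<in> vertices (Node ts) \<Longrightarrow> \<pi> (x # v) = \<rho> x # \<phi> x v" .
  have inj\<rho>: "inj_on \<rho> (slots ts)"
  proof (rule inj_onI)
    fix x y assume xy: "x \<in> slots ts" "y \<in> slots ts" "\<rho> x = \<rho> y"
    then have "\<pi> [x] = \<pi> [y]" using single by simp
    then have "[x] = [y]" by (rule inj_onD[OF inj]) (use xy V nil in auto)
    then show "x = y" by simp
  qed
  have preimage: "\<exists>x v. x \<in> slots ts \<and> v \<in> vertices (fst x) \<and> \<rho> x = x' \<and> \<phi> x v = v'"
    if "x' # v' \<in> vertices (Node ts')" for x' v'
  proof -
    have "x' # v' \<in> \<pi> ` vertices (Node ts)" using that img by simp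
    then obtain u where u: "x' # v' = \<pi> u" "u \<in> vertices (Node ts)" by (rule imageE)
    then obtain x v where xv: "u = x # v" using root by (cases u) auto
    then have "x \<in> slots ts" "v \<in> vertices (fst x)" using u V by auto
    moreover have "\<rho> x = x'" "\<phi> x v = v'" using u xv Cons[of x v] by auto
    ultimately show ?thesis by blast
  qed
  have into: "\<rho> x \<in> slots ts' \<and> \<phi> x v \<in> vertices (fst (\<rho> x))" if "x # v \<in> vertices (Node ts)" for x v
  proof -
    have "\<pi> (x # v) \<in> vertices (Node ts')" using bij_betwE[OF bij] that by blast
    then show ?thesis unfolding Cons[OF that] V' .
  qed
  have "\<rho> ` slots ts = slots ts'"
  proof
    show "\<rho> ` slots ts \<subseteq> slots ts'" using into V nil by blast
    show "slots ts' \<subseteq> \<rho> ` slots ts" using preimage V' nil by blast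
  qed
  then show "bij_betw \<rho> (slots ts) (slots ts')" using inj\<rho> by (simp add: bij_betw_def)
  fix x assume x: "x \<in> slots ts"
  show "tree_iso (fst x) (fst (\<rho> x)) (\<phi> x)"
    unfolding tree_iso_def bij_betw_def
  proof (intro conjI allI impI)
    show "inj_on (\<phi> x) (vertices (fst x))"
    proof (rule inj_onI)
      fix v w assume vw: "v \<in> vertices (fst x)" "w \<in> vertices (fst x)" "\<phi> x v = \<phi> x w"
      then have "\<pi> (x # v) = \<pi> (x # w)" using Cons V x by simp
      then have "x # v = x # w" by (rule inj_onD[OF inj]) (use vw x V in auto)
      then show "v = w" by simp
    qed
    show "\<phi> x ` vertices (fst x) = vertices (fst (\<rho> x))"
    proof
      show "\<phi> x ` vertices (fst x) \<subseteq> vertices (fst (\<rho> x))" using into V x by blast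
      show "vertices (fst (\<rho> x)) \<subseteq> \<phi> x ` vertices (fst x)"
      proof
        fix v' assume "v' \<in> vertices (fst (\<rho> x))"
        then have "\<rho> x # v' \<in> vertices (Node ts')" using V' into[of x "[]"] V nil x by blast
        then obtain x' v where *: "x' \<in> slots ts" "v \<in> vertices (fst x')" "\<rho> x' = \<rho> x" "\<phi> x' v = v'"
          using preimage by blast
        then have "x' = x" using inj\<rho> x by (auto dest: inj_onD)
        then show "v' \<in> \<phi> x ` vertices (fst x)" using * by blast
      qed
    qed
    show "\<phi> x [] = []" using single x by (simp add: \<phi>_def)
    fix v y assume "v @ [y] \<in> vertices (fst x)"
    then have *: "(x # v) @ [y] \<in> vertices (Node ts)" using V x by simp
    then have xv: "x # v \<in> vertices (Node ts)"
      using is_vertex_append[of "Node ts" "x # v" "[y]"] by (simp add: vertices_def)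
    obtain z where "\<pi> ((x # v) @ [y]) = \<pi> (x # v) @ [z]" using ext[OF *] by blast
    then have "\<phi> x (v @ [y]) = \<phi> x v @ [z]" unfolding Cons[OF xv] by (simp add: \<phi>_def)
    then show "\<exists>z. \<phi> x (v @ [y]) = \<phi> x v @ [z]" by blast
  qed
qed

text \<open>An \<open>rtree\<close> is already an isomorphism class: by induction matched children
  carry equal subtrees, so both roots have every subtree with the same multiplicity. Consequently an
  automorphism moves a child only to a copy of the same subtree.\<close>

lemma tree_iso_imp_eq: "tree_iso t t' \<pi> \<Longrightarrow> t = t'"
proof (induction t arbitrary: t' \<pi>)
  case (Node ts)
  obtain ts' where t': "t' = Node ts'" by (cases t')
  define \<rho> where "\<rho> x = hd (\<pi> [x])" for x
  note dec = tree_iso_decompose[OF Node.prems[unfolded t'], folded \<rho>_def]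
  have same: "fst (\<rho> x) = fst x" if x: "x \<in> slots ts" for x
  proof -
    have "fst x \<in># ts" using x by (auto simp: slots_def)
    then show ?thesis using Node.IH dec(3)[OF x] by metis
  qed
  have bij: "bij_betw \<rho> (slots ts) (slots ts')" using dec(1) by simp
  have "ts = ts'"
  proof (rule multiset_eqI)
    fix s
    have "\<rho> ` {x \<in> slots ts. fst x = s} = {x \<in> slots ts'. fst x = s}"
      using same unfolding bij_betw_imp_surj_on[OF bij, symmetric] by force
    then have "bij_betw \<rho> {x \<in> slots ts. fst x = s} {x \<in> slots ts'. fst x = s}"
      using bij by (auto simp: bij_betw_def inj_on_def)
    from bij_betw_same_card[OF this] show "count ts s = count ts' s"
      by (simp only: card_slots_fibre)
  qed
  then show ?case by (simp add: t')
qed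

text \<open>Such a permutation amounts to an independent choice of a permutation on each fibre of g;
  \<open>join\<close> glues the choices together.\<close>

lemma card_fibre_preserving_permutations:
  assumes "finite S"
  shows "card {\<rho>. \<rho> permutes S \<and> (\<forall>x\<in>S. g (\<rho> x) = g x)} = (\<Prod>c\<in>g ` S. fact (card {x \<in> S. g x = c}))"
proof -
  let ?fib = "\<lambda>c. {x \<in> S. g x = c}"
  let ?G = "\<Pi>\<^sub>E c\<in>g ` S. {p. p permutes ?fib c}"
  define join where "join F x = (if x \<in> S then F (g x) x else x)" for F :: "'b \<Rightarrow> 'a \<Rightarrow> 'a" and x
  have fib: "F (g x) x \<in> ?fib (g x)" if "F \<in> ?G" "x \<in> S" for F x
  proof -
    have "F (g x) permutes ?fib (g x)" using that by auto
    then show ?thesis using permutes_in_image[of "F (g x)" "?fib (g x)" x] that by simp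
  qed
  have "bij_betw join ?G {\<rho>. \<rho> permutes S \<and> (\<forall>x\<in>S. g (\<rho> x) = g x)}"
  proof (rule bij_betwI')
    fix F G assume FG: "F \<in> ?G" "G \<in> ?G"
    show "join F = join G \<longleftrightarrow> F = G"
    proof
      assume eq: "join F = join G"
      show "F = G"
      proof (rule PiE_ext[OF FG])
        fix c assume c: "c \<in> g ` S"
        then have p: "F c permutes ?fib c" "G c permutes ?fib c" using FG by auto
        show "F c = G c"
        proof
          fix x show "F c x = G c x"
          proof (cases "x \<in> ?fib c")
            case True then show ?thesis using fun_cong[OF eq, of x] by (simp add: join_def split: if_splits)
          next
            case False then show ?thesis using p by (metis permutes_not_in)
          qed
        qed
      qed
    qed simp
  next
    fix F assume F: "F \<in> ?G"
    have "inj_on (join F) S"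
    proof (rule inj_onI)
      fix x y assume xy: "x \<in> S" "y \<in> S" "join F x = join F y"
      then have "F (g x) x = F (g y) y" by (simp add: join_def)
      moreover have "g x = g y" using fib[OF F xy(1)] fib[OF F xy(2)] calculation by simp
      moreover have "F (g x) permutes ?fib (g x)" using F xy by auto
      ultimately show "x = y" by (metis permutes_inj inj_eq)
    qed
    moreover have "join F ` S \<subseteq> S" using fib[OF F] by (auto simp: join_def)
    ultimately have "bij_betw (join F) S S"
      using endo_inj_surj[OF assms] by (simp add: bij_betw_def)
    then have "join F permutes S" by (rule bij_imp_permutes) (simp add: join_def)
    then show "join F \<in> {\<rho>. \<rho> permutes S \<and> (\<forall>x\<in>S. g (\<rho> x) = g x)}"
      using fib[OF F] by (simp add: join_def)
  next
    fix \<rho> assume \<rho>: "\<rho> \<in> {\<rho>. \<rho> permutes S \<and> (\<forall>x\<in>S. g (\<rho> x) = g x)}"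
    define F where "F = restrict (\<lambda>c x. if x \<in> ?fib c then \<rho> x else x) (g ` S)"
    have "(\<lambda>x. if x \<in> ?fib c then \<rho> x else x) permutes ?fib c" for c
    proof (rule bij_imp_permutes)
      have inj: "inj_on (\<lambda>x. if x \<in> ?fib c then \<rho> x else x) (?fib c)"
        using \<rho> by (auto simp: inj_on_def dest!: permutes_inj)
      have sub: "(\<lambda>x. if x \<in> ?fib c then \<rho> x else x) ` ?fib c \<subseteq> ?fib c"
        using \<rho> permutes_in_image by fastforce
      have "finite (?fib c)" using assms by simp
      then show "bij_betw (\<lambda>x. if x \<in> ?fib c then \<rho> x else x) (?fib c) (?fib c)"
        unfolding bij_betw_def using inj endo_inj_surj[OF _ sub inj] by blast
    qed auto
    then have "F \<in> ?G" by (auto simp: F_def)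
    moreover have "\<rho> = join F"
      using \<rho> by (auto simp: join_def F_def permutes_def)
    ultimately show "\<exists>F\<in>?G. \<rho> = join F" by blast
  qed
  from bij_betw_same_card[OF this]
  have "card {\<rho>. \<rho> permutes S \<and> (\<forall>x\<in>S. g (\<rho> x) = g x)} = card ?G" by simp
  also have "\<dots> = (\<Prod>c\<in>g ` S. card {p. p permutes ?fib c})"
    using assms by (intro card_PiE) auto
  also have "\<dots> = (\<Prod>c\<in>g ` S. fact (card (?fib c)))"
    using assms by (intro prod.cong refl card_permutations) auto
  finally show ?thesis .
qed

text \<open>As in a wreath product, an automorphism consists of a permutation of the root's children
  among equal subtrees and one automorphism per child. Copies of a subtree use the same vertex
  names, so no identification of the subtree at x with the one at \<open>\<rho> x\<close> has to be
  chosen.\<close>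

lemma card_automorphisms_Node:
  "card (automorphisms (Node ts)) =
    card {\<rho>. \<rho> permutes slots ts \<and> (\<forall>x\<in>slots ts. fst (\<rho> x) = fst x)} *
    (\<Prod>x\<in>slots ts. card (automorphisms (fst x)))"
proof -
  let ?R = "{\<rho>. \<rho> permutes slots ts \<and> (\<forall>x\<in>slots ts. fst (\<rho> x) = fst x)}"
  let ?G = "\<Pi>\<^sub>E x\<in>slots ts. automorphisms (fst x)"
  let ?V = "vertices (Node ts)"
  define join where "join = (\<lambda>(\<rho>, F) u. if u \<in> ?V then (case u of [] \<Rightarrow> [] | x # v \<Rightarrow> \<rho> x # F x v) else u)"
  have V: "x # v \<in> ?V \<longleftrightarrow> x \<in> slots ts \<and> v \<in> vertices (fst x)" for x v
    by (simp add: vertices_def is_vertex_Cons del: is_vertex.simps(2))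
  have nil: "[] \<in> vertices t" for t by (simp add: vertices_def)
  have joinCons: "join (\<rho>, F) (x # v) = \<rho> x # F x v" if "x \<in> slots ts" "v \<in> vertices (fst x)" for \<rho> F x v
    using that by (simp add: join_def V)
  have joinNil: "join (\<rho>, F) [] = []" for \<rho> F
    by (simp add: join_def)
  have "bij_betw join (?R \<times> ?G) (automorphisms (Node ts))"
  proof (rule bij_betwI')
    fix a a' assume aa: "a \<in> ?R \<times> ?G" "a' \<in> ?R \<times> ?G"
    obtain \<rho> F \<rho>' F' where a: "a = (\<rho>, F)" "a' = (\<rho>', F')" by (metis surj_pair)
    have perms: "\<rho> permutes slots ts" "\<rho>' permutes slots ts" and FF: "F \<in> ?G" "F' \<in> ?G"
      using aa a by auto
    show "join a = join a' \<longleftrightarrow> a = a'"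
    proof
      assume eq: "join a = join a'"
      have *: "\<rho> x = \<rho>' x \<and> F x v = F' x v" if "x \<in> slots ts" "v \<in> vertices (fst x)" for x v
        using fun_cong[OF eq, of "x # v"] that by (simp add: a joinCons)
      have "\<rho> = \<rho>'"
      proof
        fix x show "\<rho> x = \<rho>' x"
          using *[of x "[]"] nil perms by (cases "x \<in> slots ts") (auto simp: permutes_not_in)
      qed
      moreover have "F = F'"
      proof (rule PiE_ext[OF FF])
        fix x assume x: "x \<in> slots ts"
        have p: "F x permutes vertices (fst x)" "F' x permutes vertices (fst x)"
          using FF x by (auto simp: automorphisms_def)
        show "F x = F' x"
        proof
          fix v show "F x v = F' x v"
            using *[OF x, of v] p by (cases "v \<in> vertices (fst x)") (auto simp: permutes_not_in)
        qed
      qed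
      ultimately show "a = a'" by (simp add: a)
    qed simp
  next
    fix a assume aa: "a \<in> ?R \<times> ?G"
    obtain \<rho> F where a: "a = (\<rho>, F)" by (metis surj_pair)
    have perm: "\<rho> permutes slots ts" and same: "\<And>x. x \<in> slots ts \<Longrightarrow> fst (\<rho> x) = fst x"
      and F: "\<And>x. x \<in> slots ts \<Longrightarrow> F x \<in> automorphisms (fst x)"
      using aa a by auto
    have \<rho>in: "\<rho> x \<in> slots ts" if "x \<in> slots ts" for x
      using permutes_in_image[OF perm] that by simp
    have Fin: "F x v \<in> vertices (fst x)" if "x \<in> slots ts" "v \<in> vertices (fst x)" for x v
    proof -
      have "F x permutes vertices (fst x)" using F[OF that(1)] by (simp add: automorphisms_def)
      then show ?thesis using permutes_in_image that(2) by metis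
    qed
    have sub: "join a ` ?V \<subseteq> ?V"
    proof
      fix u assume "u \<in> join a ` ?V"
      then obtain w where w: "w \<in> ?V" "u = join a w" by blast
      then show "u \<in> ?V"
        by (cases w) (simp_all add: a joinCons joinNil V \<rho>in Fin same nil)
    qed
    have "inj_on (join a) ?V"
    proof (rule inj_onI)
      fix u w assume uw: "u \<in> ?V" "w \<in> ?V" "join a u = join a w"
      show "u = w"
      proof (cases u)
        case Nil
        then show ?thesis using uw by (cases w) (simp_all add: a joinCons joinNil V)
      next
        case (Cons x v)
        then obtain x' v' where w: "w = x' # v'"
          using uw by (cases w) (simp_all add: a joinCons joinNil V)
        have xs: "x \<in> slots ts" "v \<in> vertices (fst x)" "x' \<in> slots ts" "v' \<in> vertices (fst x')"
          using uw w Cons V by auto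
        have "\<rho> x = \<rho> x'" "F x v = F x' v'"
          using uw(3) xs by (simp_all add: a joinCons w Cons)
        then have "x = x'" using permutes_inj[OF perm] by (simp add: inj_eq)
        moreover have "F x permutes vertices (fst x)" using F[OF xs(1)] by (simp add: automorphisms_def)
        ultimately have "v = v'" using \<open>F x v = F x' v'\<close> by (metis permutes_inj inj_eq)
        then show ?thesis using w Cons \<open>x = x'\<close> by simp
      qed
    qed
    then have bij: "bij_betw (join a) ?V ?V"
      using endo_inj_surj[OF finite_vertices sub] by (simp add: bij_betw_def)
    then have "join a permutes ?V" by (rule bij_imp_permutes) (simp add: join_def a)
    moreover have "\<exists>y. join a (u @ [x]) = join a u @ [y]" if u: "u @ [x] \<in> ?V" for u x
    proof (cases u)
      case Nil
      then have "x \<in> slots ts" using u V by simp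
      then have "F x [] = []" using F by (auto simp: automorphisms_def)
      then show ?thesis using Nil u V by (simp add: a joinCons joinNil)
    next
      case (Cons z v)
      then have z: "z \<in> slots ts" "v @ [x] \<in> vertices (fst z)" using u V by auto
      then have v: "v \<in> vertices (fst z)" using is_vertex_append by (auto simp: vertices_def)
      have "tree_iso (fst z) (fst z) (F z)" using F[OF z(1)] automorphisms_iff_tree_iso by blast
      then obtain y where "F z (v @ [x]) = F z v @ [y]" using z unfolding tree_iso_def by blast
      then show ?thesis using z v by (simp add: a joinCons Cons)
    qed
    ultimately show "join a \<in> automorphisms (Node ts)"
      using bij by (simp add: automorphisms_iff_tree_iso tree_iso_def a joinNil)
  next
    fix \<pi> assume "\<pi> \<in> automorphisms (Node ts)"
    then have perm: "\<pi> permutes ?V" and iso: "tree_iso (Node ts) (Node ts) \<pi>"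
      by (auto simp: automorphisms_iff_tree_iso)
    \<comment> \<open>Off the slots and off the vertices the maps are extended by the identity, as
      \<open>permutes\<close> demands, while \<open>F\<close> itself is undefined off the slots, as
      \<open>\<Pi>\<^sub>E\<close> demands.\<close>
    define \<rho> where "\<rho> x = (if x \<in> slots ts then hd (\<pi> [x]) else x)" for x
    define F where "F = (\<lambda>x\<in>slots ts. \<lambda>v. if v \<in> vertices (fst x) then tl (\<pi> (x # v)) else v)"
    note dec = tree_iso_decompose[OF iso]
    have same: "fst (\<rho> x) = fst x" if "x \<in> slots ts" for x
      using tree_iso_imp_eq[OF dec(3)[OF that]] that by (simp add: \<rho>_def)
    have "\<rho> permutes slots ts"
      by (rule bij_imp_permutes[OF bij_betw_cong[THEN iffD2, OF _ dec(1)]]) (simp_all add: \<rho>_def)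
    moreover have "F x \<in> automorphisms (fst x)" if x: "x \<in> slots ts" for x
    proof -
      have i: "tree_iso (fst x) (fst x) (\<lambda>v. tl (\<pi> (x # v)))"
        using dec(3)[OF x] same[OF x] x by (simp add: \<rho>_def)
      then have bij: "bij_betw (\<lambda>v. tl (\<pi> (x # v))) (vertices (fst x)) (vertices (fst x))"
        by (simp add: tree_iso_def)
      have bijF: "bij_betw (F x) (vertices (fst x)) (vertices (fst x))"
        by (rule bij_betw_cong[THEN iffD2, OF _ bij]) (simp add: F_def x)
      then have "F x permutes vertices (fst x)"
        by (rule bij_imp_permutes) (simp add: F_def x)
      moreover have "\<exists>z. F x (v @ [y]) = F x v @ [z]" if v: "v @ [y] \<in> vertices (fst x)" for v y
      proof -
        have "v \<in> vertices (fst x)" using v is_vertex_append by (auto simp: vertices_def)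
        moreover obtain z where "tl (\<pi> (x # v @ [y])) = tl (\<pi> (x # v)) @ [z]"
          using i v unfolding tree_iso_def by blast
        ultimately show ?thesis using v by (simp add: F_def x)
      qed
      moreover have "F x [] = []" using i by (simp add: F_def x tree_iso_def)
      ultimately show ?thesis using bijF by (simp add: automorphisms_iff_tree_iso tree_iso_def)
    qed
    ultimately have "(\<rho>, F) \<in> ?R \<times> ?G" using same by (auto simp: F_def)
    moreover have "\<pi> = join (\<rho>, F)"
    proof
      fix u show "\<pi> u = join (\<rho>, F) u"
      proof (cases "u \<in> ?V")
        case False
        then show ?thesis using perm by (simp add: join_def permutes_not_in)
      next
        case True
        show ?thesis
        proof (cases u)
          case Nil
          then show ?thesis using iso by (simp add: joinNil tree_iso_def)
        next
          case (Cons x v)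
          then have xv: "x \<in> slots ts" "v \<in> vertices (fst x)" using True V by auto
          then show ?thesis using dec(2)[of x v] True Cons by (simp add: joinCons F_def \<rho>_def)
        qed
      qed
    qed
    ultimately show "\<exists>a\<in>?R \<times> ?G. \<pi> = join a" by blast
  qed
  from bij_betw_same_card[OF this]
  have "card (automorphisms (Node ts)) = card (?R \<times> ?G)" by simp
  then show ?thesis by (simp add: card_cartesian_product card_PiE finite_slots)
qed

text \<open>The factorials count the permutations of equal subtrees, the powers the automorphisms
  inside them. These are the denominators of a \<open>divided_monomial\<close> whose variables carry
  the factor 1 / \<sigma>.\<close>

lemma symmetry_Node:
  "symmetry (Node ts) = (\<Prod>s\<in>set_mset ts. fact (count ts s) * symmetry s ^ count ts s)"
proof -
  have "(\<Prod>x\<in>slots ts. symmetry (fst x)) = (\<Prod>s\<in>set_mset ts. \<Prod>i<count ts s. symmetry s)"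
    unfolding slots_def by (subst prod.Sigma) (auto intro: prod.cong)
  then show ?thesis
    using card_automorphisms_Node[of ts] card_fibre_preserving_permutations[OF finite_slots, of ts fst]
    by (simp add: symmetry_def fst_slots card_slots_fibre prod.distrib)
qed


section \<open>Taylor approximation\<close>

text \<open>The total degree stays strictly below k, so that k is the order of the remainder;
  \<open>bipoly 0\<close> is zero.\<close>

definition bipoly :: "nat \<Rightarrow> (nat \<times> nat \<Rightarrow> real) \<Rightarrow> real \<Rightarrow> real \<Rightarrow> real" where
  "bipoly k a \<xi> \<eta> = (\<Sum>(m, n) | m + n < k. a (m, n) * \<xi> ^ m * \<eta> ^ n)"

lemma bipoly_const: "bipoly (Suc k) (\<lambda>x. if x = (0, 0) then c else 0) \<xi> \<eta> = c"
proof -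
  have "bipoly (Suc k) (\<lambda>x. if x = (0, 0) then c else 0) \<xi> \<eta> =
      (\<Sum>x | fst x + snd x < Suc k. if x = (0, 0) then c else 0)"
    unfolding bipoly_def by (rule sum.cong) (simp_all add: case_prod_beta' prod_eq_iff)
  also have "\<dots> = c"
    using finite_pairs_sum_less[of "Suc k"] by (subst sum.delta) (auto simp: case_prod_beta')
  finally show ?thesis .
qed

lemma bipoly_add: "bipoly k a \<xi> \<eta> + bipoly k b \<xi> \<eta> = bipoly k (\<lambda>x. a x + b x) \<xi> \<eta>"
  unfolding bipoly_def sum.distrib[symmetric] by (rule sum.cong) (auto simp: algebra_simps)

lemma bipoly_mult_left:
  "\<xi> * bipoly k a \<xi> \<eta> = bipoly (Suc k) (\<lambda>(m, n). if m = 0 then 0 else a (m - 1, n)) \<xi> \<eta>"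
proof -
  let ?g = "\<lambda>(m, n). (if m = 0 then 0 else a (m - 1, n)) * \<xi> ^ m * \<eta> ^ n"
  have "bipoly (Suc k) (\<lambda>(m, n). if m = 0 then 0 else a (m - 1, n)) \<xi> \<eta>
      = (\<Sum>x | fst x + snd x < Suc k. ?g x)"
    unfolding bipoly_def by (rule sum.cong) auto
  also have "\<dots> = (\<Sum>x\<in>(\<lambda>(m, n). (Suc m, n)) ` {(m, n). m + n < k}. ?g x)"
  proof (rule sum.mono_neutral_right)
    show "finite {x :: nat \<times> nat. fst x + snd x < Suc k}"
      using finite_pairs_sum_less[of "Suc k"] by (simp add: case_prod_beta')
    show "\<forall>x\<in>{x. fst x + snd x < Suc k} - (\<lambda>(m, n). (Suc m, n)) ` {(m, n). m + n < k}. ?g x = 0"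
    proof
      fix x assume x: "x \<in> {x. fst x + snd x < Suc k} - (\<lambda>(m, n). (Suc m, n)) ` {(m, n). m + n < k}"
      then have "fst x = 0" by (cases x; cases "fst x") (auto simp: image_iff)
      then show "?g x = 0" by (simp add: case_prod_beta')
    qed
  qed auto
  also have "\<dots> = (\<Sum>(m, n) | m + n < k. ?g (Suc m, n))"
    by (subst sum.reindex) (auto simp: inj_on_def intro!: sum.cong)
  also have "\<dots> = \<xi> * bipoly k a \<xi> \<eta>"
    unfolding bipoly_def sum_distrib_left by (rule sum.cong) auto
  finally show ?thesis by simp
qed

lemma bipoly_swap: "bipoly k a \<xi> \<eta> = bipoly k (\<lambda>(m, n). a (n, m)) \<eta> \<xi>"
  unfolding bipoly_def
  by (rule sum.reindex_bij_witness[where i = "\<lambda>(m, n). (n, m)" and j = "\<lambda>(m, n). (n, m)"]) auto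

text \<open>Integration along the ray through (\<xi>, \<eta>), on which a monomial of bidegree (m,
  n) is a multiple of s^(m + n); hence the divisor m + n + 1.\<close>

lemma bipoly_antiderivative:
  "((\<lambda>s. s * bipoly k (\<lambda>(m, n). a (m, n) / real (Suc (m + n))) (s * \<xi>) (s * \<eta>))
     has_real_derivative bipoly k a (s * \<xi>) (s * \<eta>)) (at s)"
proof -
  have eq: "(\<lambda>s. s * bipoly k (\<lambda>(m, n). a (m, n) / real (Suc (m + n))) (s * \<xi>) (s * \<eta>)) =
     (\<lambda>s. \<Sum>x | fst x + snd x < k. a x * \<xi> ^ fst x * \<eta> ^ snd x * (s ^ Suc (fst x + snd x) / real (Suc (fst x + snd x))))"
    unfolding bipoly_def sum_distrib_left
    by (intro ext sum.cong) (auto simp: power_mult_distrib power_add)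
  have "((\<lambda>s. s ^ Suc n / real (Suc n)) has_real_derivative s ^ n) (at s)" for n
    using DERIV_cdivide[OF DERIV_pow[of "Suc n" s], of "real (Suc n)"] by (simp del: of_nat_Suc)
  then have "((\<lambda>s. \<Sum>x | fst x + snd x < k. a x * \<xi> ^ fst x * \<eta> ^ snd x * (s ^ Suc (fst x + snd x) / real (Suc (fst x + snd x))))
     has_real_derivative (\<Sum>x | fst x + snd x < k. a x * \<xi> ^ fst x * \<eta> ^ snd x * s ^ (fst x + snd x))) (at s)"
    by (intro DERIV_sum DERIV_cmult)
  also have "(\<Sum>x | fst x + snd x < k. a x * \<xi> ^ fst x * \<eta> ^ snd x * s ^ (fst x + snd x)) = bipoly k a (s * \<xi>) (s * \<eta>)"
    unfolding bipoly_def by (intro sum.cong) (auto simp: power_mult_distrib power_add)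
  finally show ?thesis unfolding eq .
qed

lemma small_combination_in_open:
  fixes z :: "'a::real_normed_vector"
  assumes "open S" "z \<in> S"
  shows "\<exists>\<delta>>0. \<forall>\<xi> \<eta>. \<bar>\<xi>\<bar> + \<bar>\<eta>\<bar> < \<delta> \<longrightarrow> z + \<xi> *\<^sub>R v1 + \<eta> *\<^sub>R v2 \<in> S"
proof -
  obtain r where r: "r > 0" "ball z r \<subseteq> S" using assms openE by blast
  define K where "K = norm v1 + norm v2 + 1"
  have K: "K > 0" by (simp add: K_def add_nonneg_pos)
  have "z + \<xi> *\<^sub>R v1 + \<eta> *\<^sub>R v2 \<in> S" if "\<bar>\<xi>\<bar> + \<bar>\<eta>\<bar> < r / K" for \<xi> \<eta>
  proof -
    have "norm (\<xi> *\<^sub>R v1 + \<eta> *\<^sub>R v2) \<le> \<bar>\<xi>\<bar> * norm v1 + \<bar>\<eta>\<bar> * norm v2"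
      using norm_triangle_ineq[of "\<xi> *\<^sub>R v1" "\<eta> *\<^sub>R v2"] by simp
    also have "\<dots> \<le> \<bar>\<xi>\<bar> * K + \<bar>\<eta>\<bar> * K"
      by (intro add_mono mult_left_mono) (auto simp: K_def)
    also have "\<dots> = (\<bar>\<xi>\<bar> + \<bar>\<eta>\<bar>) * K" by (simp add: algebra_simps)
    also have "\<dots> < r" using that K by (simp add: field_simps)
    finally have "dist z (z + \<xi> *\<^sub>R v1 + \<eta> *\<^sub>R v2) < r"
      by (metis add.assoc dist_norm dist_commute add_diff_cancel_left')
    then show ?thesis using r by auto
  qed
  then show ?thesis using r K by (intro exI[of _ "r / K"]) simp
qed

text \<open>Working with directional derivatives along two fixed vectors, and asserting only that some
  coefficients exist, avoids the symmetry of mixed partial derivatives.\<close>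

lemma Ck_on_imp_bipoly_approx:
  fixes f :: "'a::real_normed_vector \<Rightarrow> real"
  assumes "Ck_on k f S" "open S" "z \<in> S"
  shows "\<exists>a C \<delta>. \<delta> > 0 \<and> (\<forall>\<xi> \<eta>. \<bar>\<xi>\<bar> + \<bar>\<eta>\<bar> < \<delta> \<longrightarrow>
    \<bar>f (z + \<xi> *\<^sub>R v1 + \<eta> *\<^sub>R v2) - bipoly k a \<xi> \<eta>\<bar> \<le> C * (\<bar>\<xi>\<bar> + \<bar>\<eta>\<bar>) ^ k)"
  using assms(1)
proof (induction k arbitrary: f)
  case 0
  \<comment> \<open>As \<open>bipoly 0\<close> vanishes, the claim for k = 0 is local boundedness,
    which continuity provides.\<close>
  have "open (S \<inter> f -` ball (f z) 1)"
    using 0 assms(2) by (intro continuous_open_preimage) auto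
  then obtain \<delta> where \<delta>: "\<delta> > 0"
      "\<And>\<xi> \<eta>. \<bar>\<xi>\<bar> + \<bar>\<eta>\<bar> < \<delta> \<Longrightarrow> z + \<xi> *\<^sub>R v1 + \<eta> *\<^sub>R v2 \<in> S \<inter> f -` ball (f z) 1"
    using small_combination_in_open[of "S \<inter> f -` ball (f z) 1" z v1 v2] assms(3) by auto
  have "\<bar>f (z + \<xi> *\<^sub>R v1 + \<eta> *\<^sub>R v2)\<bar> \<le> \<bar>f z\<bar> + 1" if "\<bar>\<xi>\<bar> + \<bar>\<eta>\<bar> < \<delta>" for \<xi> \<eta>
    using \<delta>(2)[OF that] by (auto simp: dist_real_def)
  then show ?case using \<delta>(1)
    by (intro exI[of _ "\<lambda>_. 0"] exI[of _ "\<bar>f z\<bar> + 1"] exI[of _ \<delta>]) (simp add: bipoly_def)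
next
  case (Suc k)
  define D where "D v x = frechet_derivative f (at x) v" for v x
  have diff: "(f has_derivative (\<lambda>v. D v x)) (at x)" if "x \<in> S" for x
    unfolding D_def using Suc.prems that by (simp flip: frechet_derivative_works)
  have "Ck_on k (D v) S" for v using Suc.prems by (simp add: D_def[abs_def])
  from Suc.IH[OF this[of v1]] Suc.IH[OF this[of v2]] obtain a1 C1 \<delta>1 a2 C2 \<delta>2 where
    \<delta>1: "\<delta>1 > 0" and a1: "\<And>\<xi> \<eta>. \<bar>\<xi>\<bar> + \<bar>\<eta>\<bar> < \<delta>1 \<Longrightarrow>
      \<bar>D v1 (z + \<xi> *\<^sub>R v1 + \<eta> *\<^sub>R v2) - bipoly k a1 \<xi> \<eta>\<bar> \<le> C1 * (\<bar>\<xi>\<bar> + \<bar>\<eta>\<bar>) ^ k" and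
    \<delta>2: "\<delta>2 > 0" and a2: "\<And>\<xi> \<eta>. \<bar>\<xi>\<bar> + \<bar>\<eta>\<bar> < \<delta>2 \<Longrightarrow>
      \<bar>D v2 (z + \<xi> *\<^sub>R v1 + \<eta> *\<^sub>R v2) - bipoly k a2 \<xi> \<eta>\<bar> \<le> C2 * (\<bar>\<xi>\<bar> + \<bar>\<eta>\<bar>) ^ k"
    by blast
  obtain r where r: "r > 0" "\<And>\<xi> \<eta>. \<bar>\<xi>\<bar> + \<bar>\<eta>\<bar> < r \<Longrightarrow> z + \<xi> *\<^sub>R v1 + \<eta> *\<^sub>R v2 \<in> S"
    using small_combination_in_open[OF assms(2,3), of v1 v2] by blast
  define \<delta> where "\<delta> = min (min \<delta>1 \<delta>2) r"
  have \<delta>: "\<delta> > 0" "\<delta> \<le> \<delta>1" "\<delta> \<le> \<delta>2" "\<delta> \<le> r" using \<delta>1 \<delta>2 r(1) by (auto simp: \<delta>_def)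
  \<comment> \<open>The coefficients imitate the integral of the derivative along a segment:
    \<open>J\<close> integrates the approximations of the two directional derivatives along rays,
    and the factors \<xi> and \<eta> shift an index by one.\<close>
  define J where "J a = (\<lambda>(m, n). a (m, n) / real (Suc (m + n)))" for a :: "nat \<times> nat \<Rightarrow> real"
  define a where "a x = (if x = (0, 0) then f z else 0) +
    ((case x of (m, n) \<Rightarrow> if m = 0 then 0 else J a1 (m - 1, n)) +
     (case x of (m, n) \<Rightarrow> if n = 0 then 0 else J a2 (m, n - 1)))" for x
  have a: "bipoly (Suc k) a \<xi> \<eta> = f z + (\<xi> * bipoly k (J a1) \<xi> \<eta> + \<eta> * bipoly k (J a2) \<xi> \<eta>)" for \<xi> \<eta>
  proof -
    have "\<eta> * bipoly k (J a2) \<xi> \<eta> = bipoly (Suc k) (\<lambda>(m, n). if n = 0 then 0 else J a2 (m, n - 1)) \<xi> \<eta>"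
      unfolding bipoly_swap[of k "J a2" \<xi> \<eta>] bipoly_mult_left
      by (subst bipoly_swap) (auto simp: case_prod_unfold intro!: arg_cong[where f = "\<lambda>g. bipoly (Suc k) g \<xi> \<eta>"])
    then show ?thesis
      unfolding a_def bipoly_add[symmetric] bipoly_const bipoly_mult_left by simp
  qed
  define C where "C = \<bar>C1\<bar> + \<bar>C2\<bar>"
  have "\<bar>f (z + \<xi> *\<^sub>R v1 + \<eta> *\<^sub>R v2) - bipoly (Suc k) a \<xi> \<eta>\<bar> \<le> C * (\<bar>\<xi>\<bar> + \<bar>\<eta>\<bar>) ^ Suc k"
    if small: "\<bar>\<xi>\<bar> + \<bar>\<eta>\<bar> < \<delta>" for \<xi> \<eta>
  proof -
    \<comment> \<open>The error is followed along the segment starting at z. Its derivative combines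
      the two errors known by induction, and the mean value theorem replaces an integral.\<close>
    define \<gamma> where "\<gamma> s = z + (s * \<xi>) *\<^sub>R v1 + (s * \<eta>) *\<^sub>R v2" for s
    define R where "R s = f (\<gamma> s) - (\<xi> * (s * bipoly k (J a1) (s * \<xi>) (s * \<eta>)) + \<eta> * (s * bipoly k (J a2) (s * \<xi>) (s * \<eta>)))" for s
    define R' where "R' s = (\<xi> * D v1 (\<gamma> s) + \<eta> * D v2 (\<gamma> s)) - (\<xi> * bipoly k a1 (s * \<xi>) (s * \<eta>) + \<eta> * bipoly k a2 (s * \<xi>) (s * \<eta>))" for s
    have scaled: "\<bar>s * \<xi>\<bar> + \<bar>s * \<eta>\<bar> \<le> \<bar>\<xi>\<bar> + \<bar>\<eta>\<bar>" if "0 \<le> s" "s \<le> 1" for s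
      using that by (simp add: abs_mult mult_left_le_one_le add_mono)
    have deriv: "(R has_real_derivative R' s) (at s)" if s: "0 \<le> s" "s \<le> 1" for s
    proof -
      have in_S: "\<gamma> s \<in> S" unfolding \<gamma>_def using scaled[OF s] small \<delta>(4) by (intro r(2)) auto
      have "(\<gamma> has_derivative (\<lambda>h. h *\<^sub>R (\<xi> *\<^sub>R v1 + \<eta> *\<^sub>R v2))) (at s)"
        unfolding \<gamma>_def by (auto intro!: derivative_eq_intros simp: algebra_simps)
      from has_derivative_compose[OF this diff[OF in_S]]
      have comp: "((\<lambda>s. f (\<gamma> s)) has_derivative (\<lambda>h. D (h *\<^sub>R (\<xi> *\<^sub>R v1 + \<eta> *\<^sub>R v2)) (\<gamma> s))) (at s)" .
      have lin: "linear (\<lambda>v. D v (\<gamma> s))"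
        by (rule has_derivative_linear[OF diff[OF in_S]])
      have "D (h *\<^sub>R (\<xi> *\<^sub>R v1 + \<eta> *\<^sub>R v2)) (\<gamma> s) = (\<xi> * D v1 (\<gamma> s) + \<eta> * D v2 (\<gamma> s)) * h" for h
        by (simp add: linear_add[OF lin] linear_cmul[OF lin] algebra_simps)
      with comp have "((\<lambda>s. f (\<gamma> s)) has_real_derivative (\<xi> * D v1 (\<gamma> s) + \<eta> * D v2 (\<gamma> s))) (at s)"
        by (simp add: has_field_derivative_def)
      then show ?thesis
        unfolding R_def R'_def J_def
        by (intro DERIV_diff DERIV_add DERIV_cmult bipoly_antiderivative)
    qed
    obtain s where s: "0 < s" "s < 1" "R 1 - R 0 = R' s"
      using MVT2[of 0 1 R R'] deriv by auto
    have \<epsilon>: "\<bar>D vi (\<gamma> s) - bipoly k ai (s * \<xi>) (s * \<eta>)\<bar> \<le> \<bar>Ci\<bar> * (\<bar>\<xi>\<bar> + \<bar>\<eta>\<bar>) ^ k"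
      if "\<And>\<xi> \<eta>. \<bar>\<xi>\<bar> + \<bar>\<eta>\<bar> < \<delta> \<Longrightarrow> \<bar>D vi (z + \<xi> *\<^sub>R v1 + \<eta> *\<^sub>R v2) - bipoly k ai \<xi> \<eta>\<bar> \<le> Ci * (\<bar>\<xi>\<bar> + \<bar>\<eta>\<bar>) ^ k" for vi ai Ci
    proof -
      have "\<bar>D vi (\<gamma> s) - bipoly k ai (s * \<xi>) (s * \<eta>)\<bar> \<le> Ci * (\<bar>s * \<xi>\<bar> + \<bar>s * \<eta>\<bar>) ^ k"
        unfolding \<gamma>_def using scaled[of s] s small by (intro that) auto
      also have "\<dots> \<le> \<bar>Ci\<bar> * (\<bar>\<xi>\<bar> + \<bar>\<eta>\<bar>) ^ k"
        using scaled[of s] s by (intro mult_mono power_mono) auto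
      finally show ?thesis .
    qed
    have "R 1 - R 0 = f (z + \<xi> *\<^sub>R v1 + \<eta> *\<^sub>R v2) - bipoly (Suc k) a \<xi> \<eta>"
      by (simp add: R_def a \<gamma>_def)
    then have "\<bar>f (z + \<xi> *\<^sub>R v1 + \<eta> *\<^sub>R v2) - bipoly (Suc k) a \<xi> \<eta>\<bar> = \<bar>R' s\<bar>" using s by simp
    also have "R' s = \<xi> * (D v1 (\<gamma> s) - bipoly k a1 (s * \<xi>) (s * \<eta>)) + \<eta> * (D v2 (\<gamma> s) - bipoly k a2 (s * \<xi>) (s * \<eta>))"
      by (simp add: R'_def algebra_simps)
    also have "\<bar>\<dots>\<bar> \<le> \<bar>\<xi>\<bar> * \<bar>D v1 (\<gamma> s) - bipoly k a1 (s * \<xi>) (s * \<eta>)\<bar> + \<bar>\<eta>\<bar> * \<bar>D v2 (\<gamma> s) - bipoly k a2 (s * \<xi>) (s * \<eta>)\<bar>"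
      by (metis abs_mult abs_triangle_ineq)
    also have "\<dots> \<le> (\<bar>\<xi>\<bar> + \<bar>\<eta>\<bar>) * (\<bar>C1\<bar> * (\<bar>\<xi>\<bar> + \<bar>\<eta>\<bar>) ^ k) + (\<bar>\<xi>\<bar> + \<bar>\<eta>\<bar>) * (\<bar>C2\<bar> * (\<bar>\<xi>\<bar> + \<bar>\<eta>\<bar>) ^ k)"
      by (intro add_mono mult_mono \<epsilon> a1 a2) (use \<delta> in auto)
    also have "\<dots> = C * (\<bar>\<xi>\<bar> + \<bar>\<eta>\<bar>) ^ Suc k" by (simp add: C_def algebra_simps)
    finally show ?thesis .
  qed
  then show ?case using \<delta>(1) by blast
qed


section \<open>Equality of functions up to a power of the step size\<close>

text \<open>Congruence modulo O(h^k) as h tends to 0, so that truncated expansions can be chained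
  and substituted like equations.\<close>

definition eq_upto :: "nat \<Rightarrow> (real \<Rightarrow> real) \<Rightarrow> (real \<Rightarrow> real) \<Rightarrow> bool" where
  "eq_upto k f g \<longleftrightarrow> (\<lambda>h. f h - g h) \<in> O[at 0](\<lambda>h. h ^ k)"

lemma power_in_bigo_power:
  assumes "k \<le> n"
  shows "(\<lambda>h::real. h ^ n) \<in> O[at 0](\<lambda>h. h ^ k)"
proof (rule bigoI[of _ 1])
  have "\<forall>\<^sub>F h in at (0::real). \<bar>h\<bar> < 1"
    by (rule order_tendstoD[of _ 0]) (auto intro!: tendsto_eq_intros)
  then show "\<forall>\<^sub>F h in at (0::real). norm (h ^ n) \<le> 1 * norm (h ^ k)"
    by eventually_elim (use assms in \<open>auto simp: power_abs intro!: power_decreasing\<close>)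
qed

lemma power_in_bigo_1: "(\<lambda>h::real. h ^ n) \<in> O[at 0](\<lambda>_. 1)"
  using power_in_bigo_power[of 0 n] by simp

lemma eq_upto_refl [simp]: "eq_upto k f f"
  by (simp add: eq_upto_def)

lemma eq_upto_sym: "eq_upto k f g \<Longrightarrow> eq_upto k g f"
  unfolding eq_upto_def by (subst landau_o.big.uminus_in_iff[symmetric]) simp

lemma eq_upto_trans [trans]:
  assumes "eq_upto k f g" "eq_upto k g l"
  shows "eq_upto k f l"
  using sum_in_bigo(1)[OF assms[unfolded eq_upto_def]] by (simp add: eq_upto_def)

lemma eq_upto_add:
  assumes "eq_upto k f f'" "eq_upto k g g'"
  shows "eq_upto k (\<lambda>h. f h + g h) (\<lambda>h. f' h + g' h)"
  using sum_in_bigo(1)[OF assms[unfolded eq_upto_def]] by (simp add: eq_upto_def algebra_simps)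

lemma eq_upto_diff:
  assumes "eq_upto k f f'" "eq_upto k g g'"
  shows "eq_upto k (\<lambda>h. f h - g h) (\<lambda>h. f' h - g' h)"
  using sum_in_bigo(2)[OF assms[unfolded eq_upto_def]] by (simp add: eq_upto_def algebra_simps)

lemma eq_upto_sum:
  assumes "\<And>i. i \<in> I \<Longrightarrow> eq_upto k (f i) (g i)"
  shows "eq_upto k (\<lambda>h. \<Sum>i\<in>I. f i h) (\<lambda>h. \<Sum>i\<in>I. g i h)"
  using assms by (induction I rule: infinite_finite_induct) (auto intro!: eq_upto_add)

text \<open>The splitting f g - f' g' = (f - f') g + f' (g - g') is the reason why boundedness is
  asked of one factor from each side.\<close>

lemma eq_upto_mult:
  assumes "eq_upto k f f'" "eq_upto k g g'" "f' \<in> O[at 0](\<lambda>_. 1)" "g \<in> O[at 0](\<lambda>_. 1)"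
  shows "eq_upto k (\<lambda>h. f h * g h) (\<lambda>h. f' h * g' h)"
proof -
  have "(\<lambda>h. (f h - f' h) * g h + f' h * (g h - g' h)) \<in> O[at 0](\<lambda>h. h ^ k)"
    using landau_o.big.mult[OF assms(1)[unfolded eq_upto_def] assms(4)]
      landau_o.big.mult[OF assms(3) assms(2)[unfolded eq_upto_def]]
    by (intro sum_in_bigo(1)) simp_all
  then show ?thesis by (simp add: eq_upto_def algebra_simps)
qed

lemma eq_upto_cmult: "eq_upto k f g \<Longrightarrow> eq_upto k (\<lambda>h. c * f h) (\<lambda>h. c * g h)"
  unfolding eq_upto_def right_diff_distrib[symmetric] by (cases "c = 0") simp_all

lemma eq_upto_mono: "eq_upto k f g \<Longrightarrow> j \<le> k \<Longrightarrow> eq_upto j f g"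
  unfolding eq_upto_def using power_in_bigo_power landau_o.big_trans by blast

lemma eq_upto_power_0: "k \<le> n \<Longrightarrow> eq_upto k (\<lambda>h. c * h ^ n) (\<lambda>_. 0)"
  unfolding eq_upto_def using power_in_bigo_power[of k n] by (cases "c = 0") simp_all

text \<open>The order gained from a factor h advances the induction for the stages, as integration
  does for the exact solution.\<close>

lemma eq_upto_scale: "eq_upto k f g \<Longrightarrow> eq_upto (Suc k) (\<lambda>h. h * f h) (\<lambda>h. h * g h)"
  unfolding eq_upto_def using landau_o.big.mult[of "\<lambda>h. h" "at 0" "\<lambda>h. h" "\<lambda>h. f h - g h" "\<lambda>h. h ^ k"]
  by (simp add: algebra_simps)

lemma eq_upto_bounded:
  assumes "eq_upto k f g" "g \<in> O[at 0](\<lambda>_. 1)"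
  shows "f \<in> O[at 0](\<lambda>_. 1)"
proof -
  have "(\<lambda>h. f h - g h) \<in> O[at 0](\<lambda>_. 1)"
    using assms(1) power_in_bigo_1 landau_o.big_trans unfolding eq_upto_def by blast
  from sum_in_bigo(1)[OF this assms(2)] show ?thesis by simp
qed

lemma bigo_1_power: "f \<in> O[at 0](\<lambda>_. 1) \<Longrightarrow> (\<lambda>h::real. f h ^ n :: real) \<in> O[at 0](\<lambda>_. 1)"
  using landau_o.big_power[of f "at 0" "\<lambda>_. 1" n] by simp

lemma eq_upto_power:
  assumes "eq_upto k f g" "g \<in> O[at 0](\<lambda>_. 1)"
  shows "eq_upto k (\<lambda>h. f h ^ n) (\<lambda>h. g h ^ n)"
proof (induction n)
  case (Suc n)
  show ?case unfolding power_Suc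
    by (rule eq_upto_mult[OF assms(1) Suc assms(2)])
      (rule bigo_1_power[OF eq_upto_bounded[OF assms]])
qed simp

text \<open>Uniqueness of asymptotic expansions: once the lower coefficients are gone, cancelling
  h^q leaves a constant that is O(h).\<close>

lemma eq_upto_polynomial_imp_0:
  assumes "eq_upto (Suc p) (\<lambda>h. \<Sum>q\<le>p. a q * h ^ q) (\<lambda>_. 0)" "q \<le> p"
  shows "a q = 0"
  using assms(2)
proof (induction q rule: less_induct)
  case (less q)
  have lower: "a i = 0" if "i < q" for i using less that by simp
  have "eq_upto (Suc q) (\<lambda>h. \<Sum>i\<le>p. a i * h ^ i) (\<lambda>h. \<Sum>i\<le>p. if i = q then a q * h ^ q else 0)"
  proof (rule eq_upto_sum)
    fix i
    show "eq_upto (Suc q) (\<lambda>h. a i * h ^ i) (\<lambda>h. if i = q then a q * h ^ q else 0)"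
      using lower[of i] by (cases i q rule: linorder_cases) (auto intro: eq_upto_power_0)
  qed
  also have "(\<lambda>h. \<Sum>i\<le>p. if i = q then a q * h ^ q else 0) = (\<lambda>h. a q * h ^ q)"
    using less.prems by simp
  finally have "eq_upto (Suc q) (\<lambda>h. a q * h ^ q) (\<lambda>_. 0)"
    using eq_upto_trans[OF eq_upto_sym eq_upto_mono[OF assms(1)]] less.prems by simp
  then have *: "(\<lambda>h. h ^ q * a q) \<in> O[at 0](\<lambda>h. h ^ q * h)"
    by (simp add: eq_upto_def mult_ac)
  have "\<forall>\<^sub>F h in at (0::real). h \<noteq> 0"
    by (rule eventually_neq_at_within)
  then have "\<forall>\<^sub>F h in at (0::real). h ^ q \<noteq> 0"
    by eventually_elim simp
  from landau_o.big.mult_cancel_left[OF bigtheta_refl this] * have "(\<lambda>_. a q) \<in> O[at 0](\<lambda>h::real. h)"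
    by (rule iffD1)
  then obtain c where c: "\<forall>\<^sub>F h in at (0::real). norm (a q) \<le> c * norm h"
    by (rule landau_o.bigE)
  have "((\<lambda>h::real. c * norm h) \<longlongrightarrow> c * norm (0::real)) (at 0)"
    by (intro tendsto_intros)
  from tendsto_lowerbound[OF this c] show "a q = 0" by simp
qed


section \<open>Elementary differentials and B-series\<close>

text \<open>The coordinate with which a tree enters as a child: 1 for a leaf, measured along (f, 1),
  and the elementary differential for any other tree, measured along (1, 0). A leaf child has no
  factor of its own; it is counted in the stump of its parent.\<close>

definition inner_differential :: "(nat \<times> nat \<Rightarrow> real) \<Rightarrow> rtree \<Rightarrow> real" where
  "inner_differential D t = \<Prod>\<^sub># (image_mset D (inner_stumps t))"

definition elementary_differential :: "(nat \<times> nat \<Rightarrow> real) \<Rightarrow> rtree \<Rightarrow> real" where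
  "elementary_differential D t = \<Prod>\<^sub># (image_mset D (stump_factors t))"

lemma tree_order_leaf [simp]: "tree_order leaf = 1"
  by simp

lemma tree_order_neq_0: "tree_order t \<noteq> 0"
  using tree_order_pos[of t] by simp

lemma tree_order_less_2:
  assumes "tree_order t < 2"
  shows "t = leaf"
proof (cases t)
  case (Node ts)
  have "\<Sum>\<^sub># (image_mset tree_order ts) < 1" using assms unfolding Node tree_order.simps by linarith
  then have "size ts < 1" by (rule le_less_trans[OF size_le_sum_order])
  then show ?thesis using Node by simp
qed

lemma symmetry_leaf [simp]: "symmetry leaf = 1"
  by (simp add: symmetry_Node)

lemma inner_differential_leaf [simp]: "inner_differential D leaf = 1"
  by (simp add: inner_differential_def)

lemma elementary_differential_leaf [simp]: "elementary_differential D leaf = D (0, 0)"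
  by (simp add: elementary_differential_def stump_factors_def)

lemma elementary_differential_nonleaf:
  "t \<noteq> leaf \<Longrightarrow> elementary_differential D t = inner_differential D t"
  by (simp add: elementary_differential_def inner_differential_def stump_factors_def)

text \<open>The factor s_00 assigned to the one-vertex tree makes the recursion hold for a root
  without children as well.\<close>

lemma elementary_differential_Node:
  "elementary_differential D (Node ts) =
    D (count ts leaf, size ts - count ts leaf) * \<Prod>\<^sub># (image_mset (inner_differential D) ts)"
proof (cases "ts = {#}")
  case False
  have "\<Prod>\<^sub># (image_mset D (\<Sum>\<^sub># (image_mset inner_stumps ts))) = \<Prod>\<^sub># (image_mset (inner_differential D) ts)"
    by (induction ts) (simp_all add: inner_differential_def)
  then show ?thesis using False
    by (simp add: elementary_differential_def stump_factors_def size_filter_neq filter_eq_replicate_mset)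
qed simp

text \<open>A term of the expanded Taylor polynomial is the B-series term of the tree with children
  M. By \<open>symmetry_Node\<close> the factorials and the symmetries of the children merge into
  the symmetry of that tree; the exponent is one short because the new root has not yet been paid
  for by a factor h.\<close>

lemma divided_monomial_bseries_terms:
  "D (count M leaf, size M - count M leaf) *
      divided_monomial (\<lambda>t. e t * inner_differential D t / real (symmetry t) * h ^ tree_order t) M =
    \<Prod>\<^sub># (image_mset e M) * elementary_differential D (Node M) / real (symmetry (Node M)) *
      h ^ (tree_order (Node M) - 1)"
proof -
  have pow: "\<Prod>\<^sub># (image_mset (\<lambda>t. h ^ tree_order t) M) = h ^ \<Sum>\<^sub># (image_mset tree_order M)"
    by (induction M) (simp_all add: power_add)
  show ?thesis
    unfolding elementary_differential_Node divided_monomial_def symmetry_Node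
    using pow
    by (simp add: image_prod_mset_multiplicity prod.distrib prod_dividef power_mult_distrib power_divide mult_ac)
qed

text \<open>For the vector field \<open>f (y, x)\<close> near \<open>(y0, x0)\<close> the directions \<open>(f (y0, x0), 1)\<close> and
  \<open>(1, 0)\<close> are the values of the elementary differentials of the autonomous system at a leaf and
  at any other tree. In these coordinates \<open>D (m, n)\<close> is the value of the atomic stump with \<open>m\<close>
  leaves and \<open>n\<close> unfilled valencies.\<close>

definition stump_values ::
  "(real \<times> real \<Rightarrow> real) \<Rightarrow> real \<Rightarrow> real \<Rightarrow> nat \<Rightarrow> (nat \<times> nat \<Rightarrow> real) \<Rightarrow> bool" where
  "stump_values f y0 x0 p D \<longleftrightarrow> (\<exists>C \<delta>. \<delta> > 0 \<and> (\<forall>\<xi> \<eta>. \<bar>\<xi>\<bar> + \<bar>\<eta>\<bar> < \<delta> \<longrightarrow>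
     \<bar>f (y0 + D (0, 0) * \<xi> + \<eta>, x0 + \<xi>) - bipoly p (\<lambda>(m, n). D (m, n) / (fact m * fact n)) \<xi> \<eta>\<bar>
       \<le> C * (\<bar>\<xi>\<bar> + \<bar>\<eta>\<bar>) ^ p))"

text \<open>The Taylor approximation is taken along (f (y0, x0), 1), whereas
  \<open>stump_values\<close> refers to D (0, 0). They agree because for p \<ge> 1 the error bound
  at \<xi> = \<eta> = 0 forces the constant coefficient to be the value of f.\<close>

lemma smooth_on_imp_stump_values:
  assumes "smooth_on f S" "open S" "(y0, x0) \<in> S" "p \<ge> 1"
  shows "\<exists>D. stump_values f y0 x0 p D"
proof -
  define f0 where "f0 = f (y0, x0)"
  obtain a C \<delta> where \<delta>: "\<delta> > 0" and C: "\<And>\<xi> \<eta>. \<bar>\<xi>\<bar> + \<bar>\<eta>\<bar> < \<delta> \<Longrightarrow>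
      \<bar>f ((y0, x0) + \<xi> *\<^sub>R (f0, 1) + \<eta> *\<^sub>R (1, 0)) - bipoly p a \<xi> \<eta>\<bar> \<le> C * (\<bar>\<xi>\<bar> + \<bar>\<eta>\<bar>) ^ p"
    using Ck_on_imp_bipoly_approx[of p f S "(y0, x0)" "(f0, 1)" "(1, 0)"] assms
    unfolding smooth_on_def by auto
  define D where "D = (\<lambda>(m, n). a (m, n) * (fact m * fact n))"
  have D: "(\<lambda>(m, n). D (m, n) / (fact m * fact n)) = a"
    by (auto simp: D_def)
  have "bipoly p a 0 0 = a (0, 0) + (\<Sum>(m, n)\<in>{(m, n). m + n < p} - {(0, 0)}. a (m, n) * 0 ^ m * 0 ^ n)"
    unfolding bipoly_def using assms(4) by (subst sum.remove[of _ "(0, 0)"]) (auto simp: finite_pairs_sum_less)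
  also have "(\<Sum>(m, n)\<in>{(m, n). m + n < p} - {(0, 0)}. a (m, n) * 0 ^ m * 0 ^ n) = 0"
    by (intro sum.neutral) auto
  finally have "D (0, 0) = f0"
    using C[of 0 0] \<delta> assms(4) by (simp add: D_def f0_def power_0_left)
  then have "\<bar>f (y0 + D (0, 0) * \<xi> + \<eta>, x0 + \<xi>) - bipoly p (\<lambda>(m, n). D (m, n) / (fact m * fact n)) \<xi> \<eta>\<bar>
      \<le> C * (\<bar>\<xi>\<bar> + \<bar>\<eta>\<bar>) ^ p" if "\<bar>\<xi>\<bar> + \<bar>\<eta>\<bar> < \<delta>" for \<xi> \<eta>
    using C[OF that] unfolding D by (simp add: mult.commute)
  then show ?thesis unfolding stump_values_def using \<delta> by blast
qed

section \<open>Truncated B-series and their substitution into the right-hand side\<close>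

definition bseries :: "(nat \<times> nat \<Rightarrow> real) \<Rightarrow> (rtree \<Rightarrow> real) \<Rightarrow> nat \<Rightarrow> real \<Rightarrow> real" where
  "bseries D e k h = (\<Sum>t | tree_order t \<le> k. e t * elementary_differential D t / real (symmetry t) * h ^ tree_order t)"

text \<open>The quotient of \<open>bseries\<close> by h, the shape of an expansion of f along a
  solution. It is the derivative of the series whose weights are divided by the order of the
  tree.\<close>

definition bseries_deriv :: "(nat \<times> nat \<Rightarrow> real) \<Rightarrow> (rtree \<Rightarrow> real) \<Rightarrow> nat \<Rightarrow> real \<Rightarrow> real" where
  "bseries_deriv D e k h = (\<Sum>t | tree_order t \<le> k.
     e t * elementary_differential D t / real (symmetry t) * h ^ (tree_order t - 1))"

lemma bseries_0: "bseries D e 0 h = 0"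
  by (simp add: bseries_def tree_order_neq_0)

lemma bseries_at_0: "bseries D e k 0 = 0"
  by (simp add: bseries_def power_0_left tree_order_neq_0)

lemma h_times_bseries_deriv: "h * bseries_deriv D e k h = bseries D e k h"
proof -
  have "h * h ^ (tree_order t - 1) = h ^ tree_order t" for t
    using tree_order_pos[of t] by (simp flip: power_Suc)
  then show ?thesis
    unfolding bseries_def bseries_deriv_def sum_distrib_left
    by (intro sum.cong) (simp_all add: mult.left_commute)
qed

text \<open>An equality except for k = 0, where the truncated series lacks the leaf and the extra
  term is absorbed by the error O(h).\<close>

lemma bseries_split_leaf:
  "eq_upto (Suc k) (bseries D e k) (\<lambda>h. D (0, 0) * (e leaf * h) +
    (\<Sum>t | t \<noteq> leaf \<and> tree_order t \<le> k. e t * inner_differential D t / real (symmetry t) * h ^ tree_order t))"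
proof (cases k)
  case 0
  have empty: "{t. t \<noteq> leaf \<and> tree_order t \<le> 0} = {}" using tree_order_less_2 by fastforce
  show ?thesis
    unfolding 0 empty bseries_0[abs_def]
    using eq_upto_sym[OF eq_upto_power_0[of 1 1 "D (0, 0) * e leaf"]] by (simp add: mult_ac)
next
  case (Suc j)
  let ?B = "{t. t \<noteq> leaf \<and> tree_order t \<le> k}"
  have "{t. tree_order t \<le> k} = insert leaf ?B" using Suc by (auto simp del: tree_order.simps)
  moreover have "finite ?B" by (rule finite_subset[OF _ finite_order_le[of k]]) auto
  ultimately have "bseries D e k = (\<lambda>h. D (0, 0) * (e leaf * h) +
      (\<Sum>t\<in>?B. e t * inner_differential D t / real (symmetry t) * h ^ tree_order t))"
    by (auto simp: bseries_def fun_eq_iff elementary_differential_nonleaf intro!: sum.cong)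
  then show ?thesis by simp
qed

text \<open>The weight of the leaf also governs the shift of x, whence the argument x0 + e leaf * h.
  Knowing u modulo h^(k+1) determines f modulo the same power; because of the added root this covers
  the trees with up to k + 1 vertices. Multiplication by h or integration then yields the next
  order.\<close>

lemma bseries_composition:
  assumes f: "stump_values f y0 x0 p D" and k: "k < p"
    and u: "eq_upto (Suc k) u (\<lambda>h. y0 + bseries D e k h)"
  shows "eq_upto (Suc k) (\<lambda>h. f (u h, x0 + e leaf * h))
    (bseries_deriv D (\<lambda>t. \<Prod>\<^sub># (image_mset e (children t))) (Suc k))"
proof -
  let ?B = "{t. t \<noteq> leaf \<and> tree_order t \<le> k}"
  define w where "w h t = e t * inner_differential D t / real (symmetry t) * h ^ tree_order t" for h t
  \<comment> \<open>Coordinates in the basis (f, 1), (1, 0): \<open>\<xi>\<close> is exactly the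
    leaf term, while \<open>\<eta>\<close> agrees with the sum of the other terms only up to the
    truncation error.\<close>
  define \<xi> where "\<xi> h = e leaf * h" for h
  define \<eta> where "\<eta> h = u h - y0 - D (0, 0) * \<xi> h" for h
  define P where "P = bipoly p (\<lambda>(m, n). D (m, n) / (fact m * fact n))"
  have finB: "finite ?B" by (rule finite_subset[OF _ finite_order_le[of k]]) auto
  have "eq_upto (Suc k) (\<lambda>h. u h - (y0 + D (0, 0) * \<xi> h))
      (\<lambda>h. (y0 + (D (0, 0) * (e leaf * h) + (\<Sum>t\<in>?B. w h t))) - (y0 + D (0, 0) * \<xi> h))"
    unfolding w_def
    by (intro eq_upto_diff eq_upto_refl eq_upto_trans[OF u] eq_upto_add bseries_split_leaf)
  then have \<eta>: "eq_upto (Suc k) \<eta> (\<lambda>h. \<Sum>t\<in>?B. w h t)"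
    by (simp add: \<eta>_def[abs_def] \<xi>_def algebra_simps)
  have w0: "eq_upto 1 (\<lambda>h. \<Sum>t\<in>?B. w h t) (\<lambda>h. \<Sum>t\<in>?B. 0)"
    unfolding w_def using tree_order_pos
    by (intro eq_upto_sum eq_upto_power_0) (metis One_nat_def Suc_leI)
  have "(\<lambda>h. \<Sum>t\<in>?B. w h t) \<in> O[at 0](\<lambda>_. 1)"
    by (rule eq_upto_bounded[OF w0]) simp
  note w1 = this
  have \<xi>O: "\<xi> \<in> O[at 0](\<lambda>h. h)" by (simp add: \<xi>_def[abs_def])
  have "eq_upto 1 \<eta> (\<lambda>_. 0)"
    using eq_upto_trans[OF eq_upto_mono[OF \<eta>] w0] by simp
  then have \<eta>O: "\<eta> \<in> O[at 0](\<lambda>h. h)" by (simp add: eq_upto_def)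
  have "(\<lambda>h. \<bar>\<xi> h\<bar> + \<bar>\<eta> h\<bar>) \<in> O[at 0](\<lambda>h. h)"
    using \<xi>O \<eta>O by (intro sum_in_bigo(1)) simp_all
  then obtain K where K: "K > 0" "\<forall>\<^sub>F h in at 0. norm (\<bar>\<xi> h\<bar> + \<bar>\<eta> h\<bar>) \<le> K * norm h"
    by (rule landau_o.bigE)
  obtain C \<delta> where \<delta>: "\<delta> > 0" and C: "\<And>\<xi> \<eta>. \<bar>\<xi>\<bar> + \<bar>\<eta>\<bar> < \<delta> \<Longrightarrow>
     \<bar>f (y0 + D (0, 0) * \<xi> + \<eta>, x0 + \<xi>) - P \<xi> \<eta>\<bar> \<le> C * (\<bar>\<xi>\<bar> + \<bar>\<eta>\<bar>) ^ p"
    using f unfolding stump_values_def P_def by blast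
  have "\<forall>\<^sub>F h in at (0::real). K * norm h < \<delta>"
    by (rule order_tendstoD[of _ 0]) (use \<delta> in \<open>auto intro!: tendsto_eq_intros\<close>)
  with K(2) have "\<forall>\<^sub>F h in at 0. norm (f (u h, x0 + e leaf * h) - P (\<xi> h) (\<eta> h)) \<le> (\<bar>C\<bar> * K ^ p) * norm (h ^ p)"
  proof eventually_elim
    case (elim h)
    have "\<bar>f (u h, x0 + e leaf * h) - P (\<xi> h) (\<eta> h)\<bar> \<le> C * (\<bar>\<xi> h\<bar> + \<bar>\<eta> h\<bar>) ^ p"
      using C[of "\<xi> h" "\<eta> h"] elim by (simp add: \<eta>_def \<xi>_def)
    also have "\<dots> \<le> \<bar>C\<bar> * (K * \<bar>h\<bar>) ^ p"
      using elim by (intro mult_mono power_mono) auto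
    finally show ?case by (simp add: power_mult_distrib power_abs)
  qed
  then have "eq_upto p (\<lambda>h. f (u h, x0 + e leaf * h)) (\<lambda>h. P (\<xi> h) (\<eta> h))"
    unfolding eq_upto_def by (rule bigoI)
  then have "eq_upto (Suc k) (\<lambda>h. f (u h, x0 + e leaf * h)) (\<lambda>h. P (\<xi> h) (\<eta> h))"
    by (rule eq_upto_mono) (use k in simp)
  also have "eq_upto (Suc k) (\<lambda>h. P (\<xi> h) (\<eta> h)) (\<lambda>h. P (\<xi> h) (\<Sum>t\<in>?B. w h t))"
    unfolding P_def bipoly_def
  proof (rule eq_upto_sum)
    fix x :: "nat \<times> nat"
    obtain m n where x: "x = (m, n)" by fastforce
    have "\<xi> \<in> O[at 0](\<lambda>_. 1)"
      using \<xi>O power_in_bigo_1[of 1] landau_o.big_trans by auto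
    then have "eq_upto (Suc k) (\<lambda>h. \<xi> h ^ m * \<eta> h ^ n) (\<lambda>h. \<xi> h ^ m * (\<Sum>t\<in>?B. w h t) ^ n)"
      by (intro eq_upto_mult eq_upto_refl eq_upto_power \<eta> w1 bigo_1_power eq_upto_bounded[OF \<eta>])
    then show "eq_upto (Suc k)
        (\<lambda>h. case x of (m, n) \<Rightarrow> (case (m, n) of (m, n) \<Rightarrow> D (m, n) / (fact m * fact n)) * \<xi> h ^ m * \<eta> h ^ n)
        (\<lambda>h. case x of (m, n) \<Rightarrow> (case (m, n) of (m, n) \<Rightarrow> D (m, n) / (fact m * fact n)) * \<xi> h ^ m * (\<Sum>t\<in>?B. w h t) ^ n)"
      by (auto simp only: x prod.case mult.assoc intro: eq_upto_cmult)
  qed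
  also have "(\<lambda>h. P (\<xi> h) (\<Sum>t\<in>?B. w h t)) = (\<lambda>h. \<Sum>M | set_mset M \<subseteq> insert leaf ?B \<and> size M < p.
      \<Prod>\<^sub># (image_mset e M) * elementary_differential D (Node M) / real (symmetry (Node M)) *
      h ^ (tree_order (Node M) - 1))" (is "_ = (\<lambda>h. \<Sum>M\<in>?M. ?T M h)")
  proof
    fix h
    \<comment> \<open>\<open>w h leaf\<close> equals \<open>\<xi> h\<close>, since the inner
      differential and the symmetry of a leaf are 1; so the leaf joins the other trees as one more
      variable.\<close>
    have "P (\<xi> h) (\<Sum>t\<in>?B. w h t) =
        (\<Sum>(m, n) | m + n < p. D (m, n) / (fact m * fact n) * w h leaf ^ m * (\<Sum>t\<in>?B. w h t) ^ n)"
      unfolding P_def bipoly_def by (intro sum.cong refl) (auto simp: w_def \<xi>_def)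
    also have "\<dots> = (\<Sum>M\<in>?M. D (count M leaf, size M - count M leaf) * divided_monomial (w h) M)"
      by (rule sum_bivariate_eq_sum_divided_monomials[OF finB]) simp
    also have "\<dots> = (\<Sum>M\<in>?M. ?T M h)"
      unfolding w_def divided_monomial_bseries_terms ..
    finally show "P (\<xi> h) (\<Sum>t\<in>?B. w h t) = (\<Sum>M\<in>?M. ?T M h)" .
  qed
  \<comment> \<open>The products also yield trees with more than k + 1 vertices; their terms carry
    at least h^(k+1) and fall under the error.\<close>
  also have "eq_upto (Suc k) (\<lambda>h. \<Sum>M\<in>?M. ?T M h) (\<lambda>h. \<Sum>M\<in>?M. if tree_order (Node M) \<le> Suc k then ?T M h else 0)"
  proof (rule eq_upto_sum)
    fix M
    show "eq_upto (Suc k) (?T M) (\<lambda>h. if tree_order (Node M) \<le> Suc k then ?T M h else 0)"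
    proof (cases "tree_order (Node M) \<le> Suc k")
      case False
      then have "eq_upto (Suc k) (?T M) (\<lambda>_. 0)" by (intro eq_upto_power_0) simp
      then show ?thesis using False by (simp only: if_False)
    qed (simp only: if_True eq_upto_refl)
  qed
  also have "(\<lambda>h. \<Sum>M\<in>?M. if tree_order (Node M) \<le> Suc k then ?T M h else 0) =
      bseries_deriv D (\<lambda>t. \<Prod>\<^sub># (image_mset e (children t))) (Suc k)"
  proof
    fix h
    have finM: "finite ?M"
      by (rule finite_subset[OF _ finite_bounded_multisets[of "insert leaf ?B" p]]) (use finB in auto)
    \<comment> \<open>Conversely no tree with at most k + 1 vertices is missing: its root has at
      most k < p children, each with at most k vertices.\<close>
    have sub: "M \<in> ?M" if "tree_order (Node M) \<le> Suc k" for M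
    proof -
      have le: "\<Sum>\<^sub># (image_mset tree_order M) \<le> k" using that by simp
      have "tree_order t \<le> k" if "t \<in># M" for t using order_le_sum_order[OF that] le by simp
      moreover have "size M < p" using size_le_sum_order[of M] le k by simp
      ultimately show ?thesis by auto
    qed
    have eq: "{M \<in> ?M. tree_order (Node M) \<le> Suc k} = {M. tree_order (Node M) \<le> Suc k}"
      using sub by blast
    have "(\<Sum>M\<in>?M. if tree_order (Node M) \<le> Suc k then ?T M h else 0) =
        (\<Sum>M | tree_order (Node M) \<le> Suc k. ?T M h)"
      unfolding eq[symmetric] by (rule sum.inter_filter[OF finM, symmetric])
    also have "\<dots> = bseries_deriv D (\<lambda>t. \<Prod>\<^sub># (image_mset e (children t))) (Suc k) h"
      unfolding bseries_deriv_def
      by (rule sum.reindex_bij_witness[where i = children and j = Node]) (auto simp del: tree_order.simps)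
    finally show "(\<Sum>M\<in>?M. if tree_order (Node M) \<le> Suc k then ?T M h else 0) =
      bseries_deriv D (\<lambda>t. \<Prod>\<^sub># (image_mset e (children t))) (Suc k) h" .
  qed
  finally show ?thesis .
qed


section \<open>Expansion of the numerical and of the exact solution\<close>

lemma eventually_eq_imp_eq_upto:
  assumes "\<forall>\<^sub>F h in at 0. f h = g h"
  shows "eq_upto k f g"
proof -
  have "\<forall>\<^sub>F h in at 0. f h - g h = 0" using assms by eventually_elim simp
  from landau_o.big.in_cong[OF this] show ?thesis by (simp add: eq_upto_def)
qed

lemma tendsto_imp_bigo_1: "(f \<longlongrightarrow> (l::real)) F \<Longrightarrow> f \<in> O[F](\<lambda>_. 1)"
  by (rule bigoI_tendsto[where c = l]) simp_all

text \<open>Substitution into f multiplies the weights of the children; applied to the weights of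
  the i-th stage this is the recursion defining \<phi>_i.\<close>

lemma prod_mset_stage_weights:
  "\<Prod>\<^sub># (image_mset (\<lambda>t. \<Sum>j\<in>UNIV. A $ i $ j * stage_weight A t j) (children t)) = stage_weight A t i"
  by (cases t) simp

lemma bseries_sum:
  "(\<Sum>j\<in>J. a j * bseries D (e j) k h) = bseries D (\<lambda>t. \<Sum>j\<in>J. a j * e j t) k h"
  unfolding bseries_def sum_distrib_left sum_distrib_right sum_divide_distrib
  by (subst sum.swap) (simp add: mult.assoc)

text \<open>Stages and step share this form, with a row of A or with b as coefficients, and a
  B-series is linear in its weights.\<close>

lemma stage_sum_expansion:
  assumes "\<And>j. eq_upto k (g j) (bseries_deriv D (e j) k)"
  shows "eq_upto (Suc k) (\<lambda>h. y0 + h * (\<Sum>j\<in>J. a j * g j h)) (\<lambda>h. y0 + bseries D (\<lambda>t. \<Sum>j\<in>J. a j * e j t) k h)"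
proof -
  have "h * (\<Sum>j\<in>J. a j * bseries_deriv D (e j) k h) = bseries D (\<lambda>t. \<Sum>j\<in>J. a j * e j t) k h" for h
    unfolding bseries_sum[symmetric] h_times_bseries_deriv[symmetric] sum_distrib_left
    by (simp add: mult.left_commute)
  moreover have "eq_upto (Suc k) (\<lambda>h. y0 + h * (\<Sum>j\<in>J. a j * g j h))
      (\<lambda>h. y0 + h * (\<Sum>j\<in>J. a j * bseries_deriv D (e j) k h))"
    by (intro eq_upto_add eq_upto_refl eq_upto_scale eq_upto_sum eq_upto_cmult assms)
  ultimately show ?thesis by simp
qed

section \<open>Expansion of the stages and of the numerical step\<close>

context
  fixes A :: "real^'s^'s" and c :: "real^'s" and f S x0 y0 Y p D
  assumes c: "\<And>i. c $ i = (\<Sum>j\<in>UNIV. A $ i $ j)"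
    and f: "stump_values f y0 x0 p D" and cont: "isCont f (y0, x0)"
    and Y: "rk_stages A c f S x0 y0 Y"
begin

text \<open>Each pass through the stage equations, a substitution into f followed by a factor h,
  improves the expansion by one order. The start k = 0 rests on boundedness of f along the stages,
  from continuity at (y0, x0) and convergence of the stages.\<close>

lemma rk_stages_expansion:
  assumes "k \<le> p"
  shows "eq_upto (Suc k) (\<lambda>h. Y h $ i) (\<lambda>h. y0 + bseries D (\<lambda>t. \<Sum>j\<in>UNIV. A $ i $ j * stage_weight A t j) k h)"
  using assms
proof (induction k arbitrary: i)
  case 0
  have bounded: "(\<lambda>h. f (Y h $ j, x0 + c $ j * h)) \<in> O[at 0](\<lambda>_. 1)" for j
  proof -
    have "((\<lambda>h. Y h $ j) \<longlongrightarrow> y0) (at 0)" using Y by (simp add: rk_stages_def)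
    moreover have "((\<lambda>h. x0 + c $ j * h) \<longlongrightarrow> x0) (at 0)" by (auto intro!: tendsto_eq_intros)
    ultimately have "((\<lambda>h. f (Y h $ j, x0 + c $ j * h)) \<longlongrightarrow> f (y0, x0)) (at 0)"
      by (intro isCont_tendsto_compose[OF cont] tendsto_Pair)
    then show ?thesis by (rule tendsto_imp_bigo_1)
  qed
  have "\<forall>\<^sub>F h in at 0. Y h $ i = y0 + h * (\<Sum>j\<in>UNIV. A $ i $ j * f (Y h $ j, x0 + c $ j * h))"
    using Y unfolding rk_stages_def by (auto elim!: eventually_mono)
  then have "eq_upto 1 (\<lambda>h. Y h $ i) (\<lambda>h. y0 + h * (\<Sum>j\<in>UNIV. A $ i $ j * f (Y h $ j, x0 + c $ j * h)))"
    by (rule eventually_eq_imp_eq_upto)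
  also have "eq_upto 1 (\<lambda>h. y0 + h * (\<Sum>j\<in>UNIV. A $ i $ j * f (Y h $ j, x0 + c $ j * h))) (\<lambda>h. y0 + h * (\<Sum>j\<in>UNIV. A $ i $ j * 0))"
    unfolding One_nat_def
    by (intro eq_upto_add eq_upto_refl eq_upto_scale eq_upto_sum eq_upto_cmult) (simp add: eq_upto_def bounded)
  finally show ?case by (simp add: bseries_0)
next
  case (Suc k)
  \<comment> \<open>By the row-sum condition the shift of x in a stage is the weight of the leaf, as
    the substitution lemma demands.\<close>
  have leaf: "(\<Sum>j\<in>UNIV. A $ j' $ j * stage_weight A leaf j) = c $ j'" for j'
    by (simp add: c)
  have step: "eq_upto (Suc k) (\<lambda>h. f (Y h $ j, x0 + c $ j * h)) (bseries_deriv D (\<lambda>t. stage_weight A t j) (Suc k))" for j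
    using bseries_composition[OF f _ Suc.IH[of j]] Suc.prems
    by (simp only: leaf prod_mset_stage_weights Suc_le_eq less_imp_le)
  have "\<forall>\<^sub>F h in at 0. Y h $ i = y0 + h * (\<Sum>j\<in>UNIV. A $ i $ j * f (Y h $ j, x0 + c $ j * h))"
    using Y unfolding rk_stages_def by (auto elim!: eventually_mono)
  then have "eq_upto (Suc (Suc k)) (\<lambda>h. Y h $ i) (\<lambda>h. y0 + h * (\<Sum>j\<in>UNIV. A $ i $ j * f (Y h $ j, x0 + c $ j * h)))"
    by (rule eventually_eq_imp_eq_upto)
  also note stage_sum_expansion[OF step]
  finally show ?case .
qed

text \<open>The stages enter modulo h^p; the factor h in front of the sum supplies the last
  order.\<close>

lemma rk_step_expansion:
  assumes p: "p \<ge> 1"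
  shows "eq_upto (Suc p) (rk_step b c f x0 y0 Y) (\<lambda>h. y0 + bseries D (elementary_weight A b) p h)"
proof -
  obtain k where k: "p = Suc k" using p by (cases p) auto
  have leaf: "(\<Sum>j\<in>UNIV. A $ j' $ j * stage_weight A leaf j) = c $ j'" for j'
    by (simp add: c)
  have "eq_upto p (\<lambda>h. f (Y h $ j, x0 + c $ j * h)) (bseries_deriv D (\<lambda>t. stage_weight A t j) p)" for j
    using bseries_composition[OF f _ rk_stages_expansion[of k j]] k
    by (simp only: leaf prod_mset_stage_weights lessI le_SucI order_refl)
  from stage_sum_expansion[OF this] show ?thesis
    by (simp add: rk_step_def[abs_def] elementary_weight_def[abs_def])
qed

end

section \<open>Expansion of the exact solution\<close>

lemma eq_upto_antiderivative:
  assumes F: "\<forall>\<^sub>F h in nhds 0. (F has_real_derivative f h) (at h)"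
    and G: "\<forall>\<^sub>F h in nhds 0. (G has_real_derivative g h) (at h)"
    and eq: "eq_upto k f g" and 0: "F 0 = G 0"
  shows "eq_upto (Suc k) F G"
proof -
  obtain C where C: "C > 0" "\<forall>\<^sub>F h in at 0. norm (f h - g h) \<le> C * norm (h ^ k)"
    using eq unfolding eq_upto_def by (rule landau_o.bigE)
  have "\<forall>\<^sub>F h in nhds 0. ((\<lambda>h. F h - G h) has_real_derivative f h - g h) (at h) \<and>
      (h \<noteq> 0 \<longrightarrow> norm (f h - g h) \<le> C * norm (h ^ k))"
    using F G C(2)[unfolded eventually_at_filter] by eventually_elim (auto intro: DERIV_diff)
  then obtain d where d: "d > 0" and
    D: "\<And>h. \<bar>h\<bar> < d \<Longrightarrow> ((\<lambda>h. F h - G h) has_real_derivative f h - g h) (at h)" and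
    B: "\<And>h. \<bar>h\<bar> < d \<Longrightarrow> h \<noteq> 0 \<Longrightarrow> \<bar>f h - g h\<bar> \<le> C * \<bar>h\<bar> ^ k"
    unfolding eventually_nhds_metric by (auto simp: dist_real_def power_abs)
  have "\<bar>F h - G h\<bar> \<le> C * \<bar>h\<bar> ^ Suc k" if h: "\<bar>h\<bar> < d" "h \<noteq> 0" for h
  proof -
    \<comment> \<open>The bound on f - g holds in a punctured neighbourhood, so the intermediate
      point must avoid 0; it lies strictly between 0 and h.\<close>
    have "\<exists>z. z \<noteq> 0 \<and> \<bar>z\<bar> \<le> \<bar>h\<bar> \<and> F h - G h = h * (f z - g z)"
    proof (cases "h > 0")
      case True
      then obtain z where "0 < z" "z < h" "(F h - G h) - (F 0 - G 0) = (h - 0) * (f z - g z)"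
        using MVT2[of 0 h "\<lambda>h. F h - G h" "\<lambda>h. f h - g h"] D h by auto
      then show ?thesis using 0 by (intro exI[of _ z]) auto
    next
      case False
      then obtain z where "h < z" "z < 0" "(F 0 - G 0) - (F h - G h) = (0 - h) * (f z - g z)"
        using MVT2[of h 0 "\<lambda>h. F h - G h" "\<lambda>h. f h - g h"] D h by auto
      then show ?thesis using 0 by (intro exI[of _ z]) auto
    qed
    then obtain z where z: "z \<noteq> 0" "\<bar>z\<bar> \<le> \<bar>h\<bar>" "F h - G h = h * (f z - g z)" by blast
    have "\<bar>f z - g z\<bar> \<le> C * \<bar>z\<bar> ^ k" using z h by (intro B) auto
    also have "\<dots> \<le> C * \<bar>h\<bar> ^ k" using z C(1) by (intro mult_left_mono power_mono) auto
    finally have "\<bar>h\<bar> * \<bar>f z - g z\<bar> \<le> \<bar>h\<bar> * (C * \<bar>h\<bar> ^ k)" by (rule mult_left_mono) simp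
    then show ?thesis by (simp add: z(3) abs_mult mult_ac)
  qed
  then have "\<forall>\<^sub>F h in at 0. norm (F h - G h) \<le> C * norm (h ^ Suc k)"
    unfolding eventually_at using d by (auto simp: dist_real_def power_abs abs_mult intro!: exI[of _ d])
  then show ?thesis unfolding eq_upto_def by (rule bigoI)
qed

lemma DERIV_bseries:
  "(bseries D e k has_real_derivative bseries_deriv D (\<lambda>t. real (tree_order t) * e t) k h) (at h)"
  unfolding bseries_def[abs_def] bseries_deriv_def
  by (intro DERIV_sum)
    (auto intro!: derivative_eq_intros simp: symmetry_pos[THEN gr_implies_not_zero])

text \<open>The weights 1 / t! are the fixed point of substitution followed by integration:
  substitution yields |t| / t!, and integrating h^(|t| - 1) divides by |t|.\<close>

lemma prod_mset_inverse_factorials: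
  "\<Prod>\<^sub># (image_mset (\<lambda>t. 1 / real (tree_factorial t)) (children t)) = real (tree_order t) * (1 / real (tree_factorial t))"
proof (cases t)
  case (Node ts)
  have "\<Prod>\<^sub># (image_mset (\<lambda>t. 1 / real (tree_factorial t)) ts) = 1 / real (\<Prod>\<^sub># (image_mset tree_factorial ts))"
    by (induction ts) simp_all
  then show ?thesis using tree_order_pos[of t] by (simp add: Node del: tree_order.simps)
qed

text \<open>The differential equation takes the role of the stage equations, with integration in
  place of the factor h. The start k = 0 is differentiability at x0.\<close>

lemma exact_solution_expansion:
  assumes f: "stump_values f y0 x0 p D" and y: "ivp_solution f S x0 y0 y" and "k \<le> p"
  shows "eq_upto (Suc k) (\<lambda>h. y (x0 + h)) (\<lambda>h. y0 + bseries D (\<lambda>t. 1 / real (tree_factorial t)) k h)"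
  using assms(3)
proof (induction k)
  case 0
  have "(y has_real_derivative f (y x0, x0)) (at x0)" and y0: "y x0 = y0"
    using y eventually_nhds_x_imp_x unfolding ivp_solution_def by fast+
  then have "((\<lambda>h. (y (x0 + h) - y0) / h) \<longlongrightarrow> f (y x0, x0)) (at 0)"
    by (simp add: DERIV_def)
  then have "(\<lambda>h. y (x0 + h) - y0) \<in> O[at 0](\<lambda>h. h)"
    by (rule bigoI_tendsto) (rule eventually_neq_at_within)
  then show ?case by (simp add: eq_upto_def bseries_0)
next
  case (Suc k)
  let ?e = "\<lambda>t. 1 / real (tree_factorial t)"
  have y0: "y x0 = y0" using y by (simp add: ivp_solution_def)
  have "\<forall>\<^sub>F x in nhds x0. (y has_real_derivative f (y x, x)) (at x)"
    using y unfolding ivp_solution_def by (auto elim: eventually_mono)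
  then have "\<forall>\<^sub>F h in nhds 0. (y has_real_derivative f (y (x0 + h), x0 + h)) (at (x0 + h))"
    unfolding eventually_nhds_metric by (auto simp: dist_real_def)
  \<comment> \<open>The spelling \<open>1 * h\<close> matches the shift e leaf * h of the
    substitution lemma, the leaf having weight 1.\<close>
  then have "\<forall>\<^sub>F h in nhds 0. ((\<lambda>h. y (x0 + h)) has_real_derivative f (y (x0 + h), x0 + 1 * h)) (at h)"
    by eventually_elim (simp add: DERIV_shift add.commute)
  moreover have "\<forall>\<^sub>F h in nhds 0. ((\<lambda>h. y0 + bseries D ?e (Suc k) h) has_real_derivative
      bseries_deriv D (\<lambda>t. real (tree_order t) * ?e t) (Suc k) h) (at h)"
    by (intro always_eventually allI DERIV_add[OF DERIV_const DERIV_bseries, THEN DERIV_cong]) simp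
  moreover have "eq_upto (Suc k) (\<lambda>h. f (y (x0 + h), x0 + 1 * h)) (bseries_deriv D (\<lambda>t. real (tree_order t) * ?e t) (Suc k))"
  proof -
    have "?e leaf = 1" by simp
    then show ?thesis
      using bseries_composition[OF f _ Suc.IH] Suc.prems
      by (simp only: prod_mset_inverse_factorials Suc_le_eq less_imp_le)
  qed
  moreover have "y (x0 + 0) = y0 + bseries D ?e (Suc k) 0"
    using y0 by (simp add: bseries_at_0)
  ultimately show ?case by (rule eq_upto_antiderivative)
qed

section \<open>Comparison of the two expansions\<close>

lemma bseries_by_order:
  "bseries D e p h = (\<Sum>q\<le>p. (\<Sum>t\<in>trees_of_order q. e t * elementary_differential D t / real (symmetry t)) * h ^ q)"
proof -
  have "bseries D e p h = (\<Sum>q\<le>p. \<Sum>t | t \<in> {t. tree_order t \<le> p} \<and> tree_order t = q.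
      e t * elementary_differential D t / real (symmetry t) * h ^ tree_order t)"
    unfolding bseries_def by (rule sum.group[symmetric]) (auto simp: finite_order_le)
  also have "\<dots> = (\<Sum>q\<le>p. (\<Sum>t\<in>trees_of_order q. e t * elementary_differential D t / real (symmetry t)) * h ^ q)"
    unfolding sum_distrib_right by (intro sum.cong) (auto simp: trees_of_order_def)
  finally show ?thesis .
qed

text \<open>Serves both implications, since it concerns a single problem with any solution and any
  stages: arbitrary f for sufficiency, a test problem for necessity. The case q = 0 is harmless, as
  no tree has order 0.\<close>

lemma rk_error_iff:
  assumes "\<And>i. c $ i = (\<Sum>j\<in>UNIV. A $ i $ j)" "stump_values f y0 x0 p D" "isCont f (y0, x0)"
    and "rk_stages A c f S x0 y0 Y" "ivp_solution f S x0 y0 y" "p \<ge> 1"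
  shows "(\<lambda>h. rk_step b c f x0 y0 Y h - y (x0 + h)) \<in> O[at 0](\<lambda>h. h ^ (p + 1)) \<longleftrightarrow>
    (\<forall>q\<le>p. (\<Sum>t\<in>trees_of_order q. (elementary_weight A b t - 1 / real (tree_factorial t)) *
      elementary_differential D t / real (symmetry t)) = 0)"
    (is "_ \<longleftrightarrow> (\<forall>q\<le>p. ?a q = 0)")
proof -
  have "eq_upto (Suc p) (\<lambda>h. rk_step b c f x0 y0 Y h - y (x0 + h))
      (\<lambda>h. (y0 + bseries D (elementary_weight A b) p h) - (y0 + bseries D (\<lambda>t. 1 / real (tree_factorial t)) p h))"
    by (intro eq_upto_diff rk_step_expansion[OF assms(1-4)] exact_solution_expansion[OF assms(2,5)] assms(6) order_refl)
  also have "(\<lambda>h. (y0 + bseries D (elementary_weight A b) p h) - (y0 + bseries D (\<lambda>t. 1 / real (tree_factorial t)) p h)) =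
      (\<lambda>h. \<Sum>q\<le>p. ?a q * h ^ q)"
    by (simp add: bseries_by_order left_diff_distrib diff_divide_distrib sum_subtractf)
  finally have *: "eq_upto (Suc p) (\<lambda>h. rk_step b c f x0 y0 Y h - y (x0 + h)) (\<lambda>h. \<Sum>q\<le>p. ?a q * h ^ q)" .
  have "(\<lambda>h. rk_step b c f x0 y0 Y h - y (x0 + h)) \<in> O[at 0](\<lambda>h. h ^ (p + 1)) \<longleftrightarrow>
      eq_upto (Suc p) (\<lambda>h. rk_step b c f x0 y0 Y h - y (x0 + h)) (\<lambda>_. 0)"
    by (simp add: eq_upto_def)
  also have "\<dots> \<longleftrightarrow> eq_upto (Suc p) (\<lambda>h. \<Sum>q\<le>p. ?a q * h ^ q) (\<lambda>_. 0)"
    using * eq_upto_sym eq_upto_trans by blast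
  also have "\<dots> \<longleftrightarrow> (\<forall>q\<le>p. ?a q = 0)"
  proof
    assume "eq_upto (Suc p) (\<lambda>h. \<Sum>q\<le>p. ?a q * h ^ q) (\<lambda>_. 0)"
    from eq_upto_polynomial_imp_0[OF this] show "\<forall>q\<le>p. ?a q = 0" by blast
  qed simp
  finally show ?thesis .
qed


section \<open>Isomeric classes\<close>

lemma isomeric_classes_eq:
  "isomeric_classes q = (\<lambda>M. {t \<in> trees_of_order q. stump_factors t = M}) ` (stump_factors ` trees_of_order q)"
proof -
  have "isomeric_on q `` {t} = {t' \<in> trees_of_order q. stump_factors t' = stump_factors t}"
    if "t \<in> trees_of_order q" for t
    using that by (auto simp: isomeric_on_def)
  then show ?thesis by (simp add: isomeric_classes_def quotient_def image_image UNION_singleton_eq_range)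
qed

lemma isomeric_sums_vanish_iff:
  "(\<forall>D. (\<Sum>t\<in>trees_of_order q. e t * elementary_differential D t / real (symmetry t)) = 0) \<longleftrightarrow>
   (\<forall>u\<in>isomeric_classes q. (\<Sum>t\<in>u. 1 / real (symmetry t) * e t) = 0)"
proof -
  let ?\<M> = "stump_factors ` trees_of_order q"
  define a where "a M = (\<Sum>t\<in>{t \<in> trees_of_order q. stump_factors t = M}. 1 / real (symmetry t) * e t)" for M
  have fin: "finite ?\<M>" by (simp add: finite_trees_of_order)
  have group: "(\<Sum>t\<in>trees_of_order q. e t * elementary_differential D t / real (symmetry t)) =
      (\<Sum>M\<in>?\<M>. a M * \<Prod>\<^sub># (image_mset D M))" for D
  proof -
    have "(\<Sum>t\<in>trees_of_order q. e t * elementary_differential D t / real (symmetry t)) =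
        (\<Sum>M\<in>?\<M>. \<Sum>t\<in>{t \<in> trees_of_order q. stump_factors t = M}. e t * elementary_differential D t / real (symmetry t))"
      by (rule sum.group[symmetric]) (auto simp: finite_trees_of_order)
    also have "\<dots> = (\<Sum>M\<in>?\<M>. a M * \<Prod>\<^sub># (image_mset D M))"
      unfolding a_def sum_distrib_right by (intro sum.cong) (auto simp: elementary_differential_def)
    finally show ?thesis .
  qed
  have "(\<forall>D. (\<Sum>M\<in>?\<M>. a M * \<Prod>\<^sub># (image_mset D M)) = 0) \<longleftrightarrow> (\<forall>M\<in>?\<M>. a M = 0)"
    using monomials_linearly_independent[OF fin, of a] by (blast intro: sum.neutral mult_eq_0_iff[THEN iffD2])
  then show ?thesis
    unfolding group isomeric_classes_eq by (simp add: a_def)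
qed


section \<open>Test problems\<close>

text \<open>\<open>Ck_on\<close> iterates directional derivatives, so closure of the polynomials
  under them gives smoothness by induction.\<close>

lemma real_polynomial_function_directional_derivative:
  assumes "real_polynomial_function f"
  shows "(\<forall>x. f differentiable (at x)) \<and> real_polynomial_function (\<lambda>x. frechet_derivative f (at x) v)"
  using assms
proof (induction rule: real_polynomial_function.induct)
  case (linear f)
  have "(f has_derivative f) (at x)" for x
    using linear by (rule bounded_linear_imp_has_derivative)
  from frechet_derivative_at[OF this, symmetric] this show ?case
    by (auto simp: differentiable_def)
next
  case (const c)
  then show ?case by auto
next
  case (add f g)
  then have "((\<lambda>x. f x + g x) has_derivative
      (\<lambda>v. frechet_derivative f (at x) v + frechet_derivative g (at x) v)) (at x)" for x
    by (intro has_derivative_add) (auto simp: frechet_derivative_works[symmetric])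
  from frechet_derivative_at[OF this, symmetric] this show ?case
    using add by (auto simp: differentiable_def)
next
  case (mult f g)
  then have "((\<lambda>x. f x * g x) has_derivative
      (\<lambda>v. f x * frechet_derivative g (at x) v + frechet_derivative f (at x) v * g x)) (at x)" for x
    by (intro has_derivative_mult) (auto simp: frechet_derivative_works[symmetric])
  from frechet_derivative_at[OF this, symmetric] this show ?case
    using mult by (auto simp: differentiable_def)
qed

lemma real_polynomial_function_imp_smooth_on:
  assumes "real_polynomial_function f"
  shows "smooth_on f S"
proof -
  have "Ck_on k f S" for k
    using assms
  proof (induction k arbitrary: f)
    case 0
    then show ?case
      using real_polynomial_function_directional_derivative
      by (auto intro!: continuous_at_imp_continuous_on differentiable_imp_continuous_within)
  next
    case (Suc k)
    then show ?case using real_polynomial_function_directional_derivative by auto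
  qed
  then show ?thesis by (simp add: smooth_on_def)
qed

lemma real_polynomial_function_bipoly:
  assumes "real_polynomial_function u" "real_polynomial_function v"
  shows "real_polynomial_function (\<lambda>z. bipoly k a (u z) (v z))"
  unfolding bipoly_def case_prod_beta'
  using assms finite_pairs_sum_less[of k, unfolded case_prod_beta']
  by (intro real_polynomial_function_sum real_polynomial_function.intros(4) real_polynomial_function_power
      real_polynomial_function.intros(2)) auto

text \<open>\<open>rk_stages\<close> asks for a solution at each small h and for convergence to y0.
  So a Brouwer fixed point can be picked for each h separately, with an explicit bound on its
  distance from y0.\<close>

lemma rk_stages_exist:
  fixes A :: "real^'s^'s" and c :: "real^'s"
  assumes cont: "continuous_on UNIV f"
  shows "\<exists>Y. rk_stages A c f UNIV x0 y0 Y"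
proof -
  define w :: "real^'s" where "w = (\<chi> i. y0)"
  \<comment> \<open>\<open>M\<close> bounds the shifts of x for |h| \<le> 1, so \<open>K\<close> is
    a compact box containing the arguments of f that will occur; \<open>B\<close> bounds f on it,
    and \<open>L\<close> bounds the displacement of the stages per unit of h.\<close>
  define M where "M = (\<Sum>j\<in>UNIV. \<bar>c $ j\<bar>)"
  define K where "K = cbox (y0 - 1, x0 - M) (y0 + 1, x0 + M)"
  have "bounded (f ` K)"
    unfolding K_def by (intro compact_imp_bounded compact_continuous_image compact_cbox continuous_on_subset[OF cont]) simp
  then obtain B where B: "\<And>z. z \<in> K \<Longrightarrow> \<bar>f z\<bar> \<le> B"
    unfolding bounded_iff by auto
  have K0: "(y0, x0) \<in> K" by (auto simp: K_def M_def cbox_Pair_eq sum_nonneg)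
  have B0: "B \<ge> 0" using B[OF K0] by linarith
  define L where "L = (\<Sum>i\<in>UNIV. \<Sum>j\<in>UNIV. \<bar>A $ i $ j\<bar> * B)"
  have L0: "L \<ge> 0" unfolding L_def using B0 by (intro sum_nonneg) auto
  define \<Phi> where "\<Phi> h v = (\<chi> i. y0 + h * (\<Sum>j\<in>UNIV. A $ i $ j * f (v $ j, x0 + c $ j * h)))" for h and v :: "real^'s"
  \<comment> \<open>At most 1, for the sake of the box, and with \<delta> * L \<le> 1, so that the
    unit ball is mapped into itself; the summand 1 covers L = 0.\<close>
  define \<delta> where "\<delta> = 1 / (L + 1)"
  have \<delta>: "\<delta> > 0" "\<delta> \<le> 1" "\<delta> * L \<le> 1" using L0 by (auto simp: \<delta>_def field_simps)
  have bound: "norm (\<Phi> h v - w) \<le> \<bar>h\<bar> * L" if "\<bar>h\<bar> \<le> \<delta>" "v \<in> cball w 1" for h v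
  proof -
    have inK: "(v $ j, x0 + c $ j * h) \<in> K" for j
    proof -
      have "\<bar>v $ j - y0\<bar> \<le> norm (v - w)" using component_le_norm_cart[of "v - w" j] by (simp add: w_def)
      then have v: "\<bar>v $ j - y0\<bar> \<le> 1" using that(2) by (simp add: dist_norm norm_minus_commute)
      have "\<bar>c $ j * h\<bar> \<le> \<bar>c $ j\<bar> * 1"
        unfolding abs_mult using that(1) \<delta>(2) by (intro mult_left_mono) auto
      also have "\<dots> \<le> M" unfolding M_def using member_le_sum[of j UNIV "\<lambda>j. \<bar>c $ j\<bar>"] by simp
      finally show ?thesis using v by (auto simp: K_def cbox_Pair_eq)
    qed
    have "norm (\<Phi> h v - w) \<le> (\<Sum>i\<in>UNIV. \<bar>(\<Phi> h v - w) $ i\<bar>)" by (rule norm_le_l1_cart)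
    also have "\<dots> \<le> (\<Sum>i\<in>UNIV. \<bar>h\<bar> * (\<Sum>j\<in>UNIV. \<bar>A $ i $ j\<bar> * B))"
    proof (rule sum_mono)
      fix i
      have "\<bar>\<Sum>j\<in>UNIV. A $ i $ j * f (v $ j, x0 + c $ j * h)\<bar> \<le> (\<Sum>j\<in>UNIV. \<bar>A $ i $ j * f (v $ j, x0 + c $ j * h)\<bar>)"
        by (rule sum_abs)
      also have "\<dots> \<le> (\<Sum>j\<in>UNIV. \<bar>A $ i $ j\<bar> * B)"
        unfolding abs_mult by (intro sum_mono mult_left_mono B inK) simp
      finally show "\<bar>(\<Phi> h v - w) $ i\<bar> \<le> \<bar>h\<bar> * (\<Sum>j\<in>UNIV. \<bar>A $ i $ j\<bar> * B)"
        by (simp add: \<Phi>_def w_def abs_mult mult_left_mono)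
    qed
    also have "\<dots> = \<bar>h\<bar> * L" by (simp add: L_def sum_distrib_left)
    finally show ?thesis .
  qed
  \<comment> \<open>The bound |h| * L, finer than membership in the unit ball, is what makes the
    stages converge.\<close>
  have fixed_point: "\<exists>v. \<Phi> h v = v \<and> norm (v - w) \<le> \<bar>h\<bar> * L" if h: "\<bar>h\<bar> \<le> \<delta>" for h
  proof -
    have "continuous_on (cball w 1) (\<Phi> h)"
      unfolding \<Phi>_def
      by (intro continuous_on_vec_lambda continuous_intros continuous_on_compose2[OF cont]) auto
    moreover have "\<Phi> h \<in> cball w 1 \<rightarrow> cball w 1"
    proof
      fix v assume "v \<in> cball w 1"
      then have "norm (\<Phi> h v - w) \<le> \<bar>h\<bar> * L" using bound h by blast
      also have "\<dots> \<le> \<delta> * L" using h L0 by (intro mult_right_mono) auto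
      finally show "\<Phi> h v \<in> cball w 1" using \<delta>(3) by (simp add: dist_norm norm_minus_commute)
    qed
    ultimately obtain v where v: "v \<in> cball w 1" "\<Phi> h v = v"
      using brouwer[OF compact_cball convex_cball, of w 1 "\<Phi> h"] by auto
    then show ?thesis using bound[OF h v(1)] by auto
  qed
  define Y where "Y h = (SOME v. \<Phi> h v = v \<and> norm (v - w) \<le> \<bar>h\<bar> * L)" for h
  have Y: "\<Phi> h (Y h) = Y h" "norm (Y h - w) \<le> \<bar>h\<bar> * L" if "\<bar>h\<bar> \<le> \<delta>" for h
    using someI_ex[OF fixed_point[OF that]] by (auto simp: Y_def)
  have small: "\<forall>\<^sub>F h in at (0::real). \<bar>h\<bar> \<le> \<delta>"
    unfolding eventually_at using \<delta>(1) by (auto simp: dist_real_def intro!: exI[of _ \<delta>])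
  have "((\<lambda>h. Y h $ i) \<longlongrightarrow> y0) (at 0)" for i
  proof -
    have "((\<lambda>h::real. \<bar>h\<bar> * L) \<longlongrightarrow> 0) (at 0)" by (auto intro!: tendsto_eq_intros)
    moreover have "\<forall>\<^sub>F h in at 0. norm (Y h $ i - y0) \<le> \<bar>h\<bar> * L"
      using small
    proof eventually_elim
      case (elim h)
      then show ?case using component_le_norm_cart[of "Y h - w" i] Y(2)[of h] by (simp add: w_def)
    qed
    ultimately have "((\<lambda>h. Y h $ i - y0) \<longlongrightarrow> 0) (at 0)" by (rule Lim_null_comparison[rotated])
    then show ?thesis by (simp add: LIM_zero_iff)
  qed
  moreover have "\<forall>\<^sub>F h in at 0. \<forall>i. Y h $ i = y0 + h * (\<Sum>j\<in>UNIV. A $ i $ j * f (Y h $ j, x0 + c $ j * h))"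
    using small
  proof eventually_elim
    case (elim h)
    then show ?case using Y(1)[of h] by (simp add: \<Phi>_def vec_eq_iff)
  qed
  ultimately have "rk_stages A c f UNIV x0 y0 Y" by (simp add: rk_stages_def)
  then show ?thesis by blast
qed

text \<open>The polynomial with the prescribed stump values is corrected by a function of \<open>x\<close> alone, of
  size \<open>O(x\<^sup>p)\<close>, so that the truncated B-series becomes an exact solution. This avoids an
  existence theorem for differential equations.\<close>

lemma test_problem_exists:
  assumes p: "p \<ge> 1"
  shows "\<exists>f y. smooth_on f UNIV \<and> stump_values f 0 0 p D \<and> ivp_solution f UNIV 0 0 y"
proof -
  obtain k where k: "p = Suc k" using p by (cases p) auto
  let ?e = "\<lambda>t. 1 / real (tree_factorial t)"
  define P where "P = bipoly p (\<lambda>(m, n). D (m, n) / (fact m * fact n))"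
  \<comment> \<open>The coordinates of \<open>stump_values\<close> at the origin are \<xi> = x and
    \<eta> = y - D (0, 0) * x.\<close>
  define fP where "fP z = P (snd z) (fst z - D (0, 0) * snd z)" for z
  define g where "g = bseries D ?e p"
  define g' where "g' = bseries_deriv D (\<lambda>t. real (tree_order t) * ?e t) p"
  \<comment> \<open>The defect of the truncated series \<open>g\<close> in the equation with
    right-hand side \<open>fP\<close>.\<close>
  define r where "r x = g' x - fP (g x, x)" for x
  define f where "f z = fP z + r (snd z)" for z
  have poly_proj: "real_polynomial_function (\<lambda>z. snd z :: real)" "real_polynomial_function (\<lambda>z. fst z :: real)"
    by (rule real_polynomial_function.intros(1)[OF bounded_linear_snd] real_polynomial_function.intros(1)[OF bounded_linear_fst])+
  have poly_fP: "real_polynomial_function (\<lambda>z. fP (u z, v z))"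
    if "real_polynomial_function u" "real_polynomial_function v" for u v :: "'a::real_normed_vector \<Rightarrow> real"
    unfolding fP_def P_def fst_conv snd_conv
    by (intro real_polynomial_function_bipoly real_polynomial_function_diff real_polynomial_function.intros(4)
        real_polynomial_function.intros(2) that)
  have poly_r: "real_polynomial_function (\<lambda>z. r (u z))"
    if "real_polynomial_function u" for u :: "'a::real_normed_vector \<Rightarrow> real"
    unfolding r_def g_def g'_def bseries_def bseries_deriv_def
    by (intro real_polynomial_function_diff poly_fP real_polynomial_function_sum finite_order_le
        real_polynomial_function.intros(4) real_polynomial_function.intros(2) real_polynomial_function_power that)
  have "real_polynomial_function f"
    using real_polynomial_function.intros(3)[OF poly_fP[OF poly_proj(2,1)] poly_r[OF poly_proj(1)]]
    by (simp add: f_def[abs_def])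
  then have smooth: "smooth_on f UNIV" by (rule real_polynomial_function_imp_smooth_on)
  have deriv: "(g has_real_derivative g' x) (at x)" for x
    unfolding g_def g'_def by (rule DERIV_bseries)
  have g0: "g 0 = 0"
    by (simp add: g_def bseries_at_0)
  have sol: "ivp_solution f UNIV 0 0 g"
    using deriv g0 by (simp add: ivp_solution_def f_def r_def)
  have P: "stump_values fP 0 0 p D"
    unfolding stump_values_def fP_def P_def by (intro exI[of _ 0] exI[of _ 1]) simp
  \<comment> \<open>Truncation at k = p - 1 meets the requirement k < p of the substitution lemma,
    whose conclusion at order k + 1 is the full \<open>g'\<close>; hence the defect is
    O(h^p).\<close>
  have "eq_upto p g (\<lambda>h. 0 + bseries D ?e k h)"
  proof -
    have "g = (\<lambda>h. bseries D ?e k h + (\<Sum>t\<in>trees_of_order p. ?e t * elementary_differential D t / real (symmetry t)) * h ^ p)"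
      by (simp add: g_def bseries_by_order k fun_eq_iff)
    moreover have "eq_upto p \<dots> (\<lambda>h. bseries D ?e k h + 0)"
      by (intro eq_upto_add eq_upto_refl eq_upto_power_0 order_refl)
    ultimately show ?thesis by simp
  qed
  moreover have "?e leaf = 1" by simp
  ultimately have "eq_upto p (\<lambda>h. fP (g h, 0 + 1 * h)) g'"
    using bseries_composition[OF P, of k g ?e] unfolding k g'_def
    by (simp only: prod_mset_inverse_factorials lessI)
  then have "eq_upto p g' (\<lambda>h. fP (g h, 0 + 1 * h))" by (rule eq_upto_sym)
  then have "r \<in> O[at 0](\<lambda>h. h ^ p)" by (simp add: eq_upto_def r_def[abs_def])
  then obtain C where C: "C > 0" "\<forall>\<^sub>F h in at 0. norm (r h) \<le> C * norm (h ^ p)"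
    by (rule landau_o.bigE)
  \<comment> \<open>The bound on \<open>r\<close> is known for h \<noteq> 0 only, whereas
    \<open>stump_values\<close> includes \<xi> = 0; continuity of \<open>r\<close> settles this
    point.\<close>
  have "real_polynomial_function r"
    using poly_r[OF real_polynomial_function.intros(1)[OF bounded_linear_ident]] by simp
  then have "isCont r 0"
    using real_polynomial_function_directional_derivative differentiable_imp_continuous_within by blast
  then have "(r \<longlongrightarrow> r 0) (at 0)" by (simp add: isCont_def)
  moreover have "(r \<longlongrightarrow> 0) (at 0)"
  proof (rule Lim_null_comparison[OF C(2)])
    have "((\<lambda>h::real. C * norm (h ^ p)) \<longlongrightarrow> C * norm ((0::real) ^ p)) (at 0)" by (intro tendsto_intros)
    then show "((\<lambda>h::real. C * norm (h ^ p)) \<longlongrightarrow> 0) (at 0)" using p by (simp add: power_0_left)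
  qed
  ultimately have r0: "r 0 = 0" by (rule LIM_unique)
  obtain d where d: "d > 0" "\<And>h. h \<noteq> 0 \<Longrightarrow> \<bar>h\<bar> < d \<Longrightarrow> \<bar>r h\<bar> \<le> C * \<bar>h\<bar> ^ p"
    using C(2) unfolding eventually_at by (auto simp: dist_real_def power_abs)
  have r: "\<bar>r h\<bar> \<le> C * \<bar>h\<bar> ^ p" if "\<bar>h\<bar> < d" for h
    using d(2)[of h] that r0 C(1) by (cases "h = 0") auto
  have "\<bar>f (0 + D (0, 0) * \<xi> + \<eta>, 0 + \<xi>) - P \<xi> \<eta>\<bar> \<le> C * (\<bar>\<xi>\<bar> + \<bar>\<eta>\<bar>) ^ p" if "\<bar>\<xi>\<bar> + \<bar>\<eta>\<bar> < d" for \<xi> \<eta>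
  proof -
    have "f (0 + D (0, 0) * \<xi> + \<eta>, 0 + \<xi>) - P \<xi> \<eta> = r \<xi>" by (simp add: f_def fP_def)
    also have "\<bar>r \<xi>\<bar> \<le> C * \<bar>\<xi>\<bar> ^ p" using that by (intro r) simp
    also have "\<dots> \<le> C * (\<bar>\<xi>\<bar> + \<bar>\<eta>\<bar>) ^ p" using C(1) by (intro mult_left_mono power_mono) auto
    finally show ?thesis by simp
  qed
  then have "stump_values f 0 0 p D"
    unfolding stump_values_def P_def using d(1) by blast
  then show ?thesis using smooth sol by blast
qed

lemma smooth_on_imp_isCont: "smooth_on f S \<Longrightarrow> open S \<Longrightarrow> z \<in> S \<Longrightarrow> isCont f z"
  using Ck_on.simps(1) continuous_on_eq_continuous_at unfolding smooth_on_def by blast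

theorem mainTheorem1:
  fixes A :: "real^'s^'s" and b c :: "real^'s" and p :: nat
  assumes "\<And>i. c $ i = (\<Sum>j\<in>UNIV. A $ i $ j)"
    and "p \<ge> 1"
  shows "rk_scalar_order A b c p \<longleftrightarrow>
    (\<forall>q\<in>{1..p}. \<forall>u\<in>isomeric_classes q.
      (\<Sum>t\<in>u. 1 / real (symmetry t) * (elementary_weight A b t - 1 / real (tree_factorial t))) = 0)"
proof -
  let ?e = "\<lambda>t. elementary_weight A b t - 1 / real (tree_factorial t)"
  note vanish = isomeric_sums_vanish_iff[where e = ?e]
  show ?thesis
  proof
    assume order: "rk_scalar_order A b c p"
    show "\<forall>q\<in>{1..p}. \<forall>u\<in>isomeric_classes q. (\<Sum>t\<in>u. 1 / real (symmetry t) * ?e t) = 0"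
    \<comment> \<open>By \<open>vanish\<close> it suffices that the sum over all trees of order q is
      zero for every prescription D; each D gets its own test problem.\<close>
    proof (intro ballI[where A = "{1..p}"], unfold vanish[symmetric], intro allI)
      fix q D assume q: "q \<in> {1..p}"
      obtain f y where f: "smooth_on f UNIV" "stump_values f 0 0 p D" "ivp_solution f UNIV 0 0 y"
        using test_problem_exists[OF assms(2)] by blast
      have cont: "isCont f z" for z using smooth_on_imp_isCont[OF f(1)] by simp
      then obtain Y where Y: "rk_stages A c f UNIV 0 0 Y"
        using rk_stages_exist[of f A c 0 0] by (auto simp: continuous_on_eq_continuous_at)
      have "(\<lambda>h. rk_step b c f 0 0 Y h - y (0 + h)) \<in> O[at 0](\<lambda>h. h ^ (p + 1))"
        using order f Y unfolding rk_scalar_order_def by blast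
      then show "(\<Sum>t\<in>trees_of_order q. ?e t * elementary_differential D t / real (symmetry t)) = 0"
        using rk_error_iff[OF assms(1) f(2) cont Y f(3) assms(2)] q by simp
    qed
  next
    assume sums: "\<forall>q\<in>{1..p}. \<forall>u\<in>isomeric_classes q. (\<Sum>t\<in>u. 1 / real (symmetry t) * ?e t) = 0"
    show "rk_scalar_order A b c p"
      unfolding rk_scalar_order_def
    proof (intro allI impI, elim conjE)
      fix f S x0 y0 y Y
      assume f: "open S" "(y0, x0) \<in> S" "smooth_on f S" and y: "ivp_solution f S x0 y0 y"
        and Y: "rk_stages A c f S x0 y0 Y"
      obtain D where D: "stump_values f y0 x0 p D"
        using smooth_on_imp_stump_values[OF f(3,1,2) assms(2)] by blast
      have cont: "isCont f (y0, x0)" using smooth_on_imp_isCont f by blast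
      have "(\<Sum>t\<in>trees_of_order q. ?e t * elementary_differential D t / real (symmetry t)) = 0" if "q \<le> p" for q
      proof (cases "q = 0")
        case True
        then show ?thesis by (simp add: trees_of_order_def tree_order_neq_0)
      next
        case False
        then have "q \<in> {1..p}" using that by simp
        then show ?thesis using sums unfolding vanish[symmetric] by blast
      qed
      then show "(\<lambda>h. rk_step b c f x0 y0 Y h - y (x0 + h)) \<in> O[at 0](\<lambda>h. h ^ (p + 1))"
        using rk_error_iff[OF assms(1) D cont Y y assms(2)] by blast
    qed
  qed
qed

end
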